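(* Let $m<n$, $p\le n$ be positive integers such that $m+p-n>0$ is sufficiently large that limiting distributions for the $\chi^2$ result hold, and let $G\in\mathbb{R}^{m\times n}$ and $L\in\mathbb{R}^{p\times n}$ have full row rank $m$ and $p$ respectively. Let $C_{\mathbf d}\in\mathbb{R}^{m\times m}$ and $C_{\mathbf m}\in\mathbb{R}^{n\times n}$ be symmetric positive definite, and let $\hat{\mathbf m},\mathbf m_0\in\mathbb{R}^n$ be fixed vectors. Let $\mathbf n\sim\mathbb{N}(0,C_{\mathbf d})$ and $\mathbf m\sim\mathbb{N}(\hat{\mathbf m},C_{\mathbf m})$ be independent random vectors, so that $\mathbf m-\mathbf m_0\sim\mathbb{N}(\hat{\mathbf m}-\mathbf m_0,C_{\mathbf m})$ and $L(\mathbf m-\mathbf m_0)\sim\mathbb{N}(L(\hat{\mathbf m}-\mathbf m_0),C_L)$ with $C_L:=LC_{\mathbf m}L^T$. Set $\mathbf d_{\mathrm{obs}}=G\mathbf m+\mathbf n$. Let $W_{\mathbf d}\in\mathbb{R}^{m\times m}$ satisfy $W_{\mathbf d}^TW_{\mathbf d}=C_{\mathbf d}^{-1}$, let $W_L:=\sqrt{C_L^{-1}}$ (so $W_L^TW_L=C_L^{-1}$), and assume the invertibility condition $\mathcal N(W_LL)\cap\mathcal N(W_{\mathbf d}G)=\{0\}$. Define $$P^{W_L}(\mathbf x):=\|W_{\mathbf d}(G\mathbf x-\mathbf d_{\mathrm{obs}})\|_2^2+\|W_LL(\mathbf x-\mathbf m_0)\|_2^2,\qquad \mathbf x\in\mathbb{R}^n,$$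 and let $\mathbf m_{\mathrm{Tik}}(W_L)$ be its unique minimizer over $\mathbf x\in\mathbb{R}^n$. Let $U$ and $Q$ be the $m\times m$ matrices obtained from a generalized singular value decomposition of the pair $[W_{\mathbf d}G;\,W_LL]$ as described in the context. Then: (1) if $\mathbf m_0=\hat{\mathbf m}$, then $P^{W_L}(\mathbf m_{\mathrm{Tik}}(W_L))\sim\chi^2(m+p-n,0)$; (2) if $\mathbf m_0\ne\hat{\mathbf m}$, then $P^{W_L}(\mathbf m_{\mathrm{Tik}}(W_L))\sim\chi^2(m+p-n,c)$ with $c=\|QU^TW_{\mathbf d}G(\hat{\mathbf m}-\mathbf m_0)\|_2^2$. Equivalently, the minimum value of the functional $P^{W_L}$ is a random variable which follows a $\chi^2$ distribution with $m+p-n$ degrees of freedom and centrality parameter $c=\|QU^TW_{\mathbf d}G(\hat{\mathbf m}-\mathbf m_0)\|_2^2$.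
   Context: Notation. $\mathbf y\sim\mathbb{N}(\hat{\mathbf y},C)$ means that $\mathbf y$ is normally distributed with mean $\hat{\mathbf y}$ and covariance matrix $C$. $\mathcal N(A)$ denotes the null space of $A$. $\chi^2(d,c)$ denotes the (non-central) $\chi^2$ distribution with $d$ degrees of freedom and centrality parameter $c$, i.e. the distribution of $\sum_{i=1}^d Z_i^2$ for independent $Z_i\sim\mathbb{N}(a_i,1)$ with $\sum_i a_i^2=c$; $c=0$ is the ordinary (central) $\chi^2$ distribution. The hypothesis that $m+p-n$ is sufficiently large that limiting distributions for the $\chi^2$ result hold is stated qualitatively, with no explicit threshold. Generalized singular value decomposition (GSVD). Put $\tilde G:=W_{\mathbf d}G$ (size $m\times n$, rank $m<n$), $\tilde L:=W_LL$ (size $p\times n$, rank $p\le n$), $q:=n-m$. Since $\mathcal N(\tilde L)\cap\mathcal N(\tilde G)=\{0\}$, the stacked matrix $[\tilde G;\tilde L]$ has full column rank $n$, and there exist orthogonal matrices $U\in\mathbb{R}^{m\times m}$, $V\in\mathbb{R}^{p\times p}$ and an invertible $X\in\mathbb{R}^{n\times n}$ such that $$\tilde G=U\tilde\Upsilon X^T,\qquad \tilde L=V\tilde MX^T,$$ where $\tilde\Upsilon=[\,0_{m\times q}\ \ \Upsilon\,]$ with $\Upsilon=\mathrm{diag}(\nu_{q+1},\dots,\nu_p,1,\dots,1)\in\mathbb{R}^{m\times m}$ (the last $n-p$ diagonal entries equal to $1$), $\tilde M=[\,M\ \ 0_{p\times(n-p)}\,]$ with $M=\mathrm{diag}(1,\dots,1,\mu_{q+1},\dots,\mu_p)\in\mathbb{R}^{p\times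 p}$ (the first $q$ diagonal entries equal to $1$), and $$0<\nu_{q+1}\le\dots\le\nu_p<1,\qquad 1>\mu_{q+1}\ge\dots\ge\mu_p>0,\qquad \nu_i^2+\mu_i^2=1.$$ The matrix $Q$ is $Q:=\mathrm{diag}(\mu_{q+1},\dots,\mu_p,0,\dots,0)\in\mathbb{R}^{m\times m}$, with the last $n-p$ diagonal entries equal to $0$. *)

theory Defs
  imports "HOL-Probability.Probability"
begin

section \<open>Symmetric positive (semi)definite matrices\<close>

definition sym_pos_def :: "real^'n^'n \<Rightarrow> bool" where
  "sym_pos_def A \<longleftrightarrow> transpose A = A \<and> (\<forall>x. x \<noteq> 0 \<longrightarrow> 0 < x \<bullet> (A *v x))"

definition sym_pos_semidef :: "real^'n^'n \<Rightarrow> bool" where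
  "sym_pos_semidef A \<longleftrightarrow> transpose A = A \<and> (\<forall>x. 0 \<le> x \<bullet> (A *v x))"

text \<open>The principal square root; meaningful for symmetric positive semidefinite \<open>A\<close>.\<close>

definition matrix_sqrt :: "real^'n^'n \<Rightarrow> real^'n^'n" where
  "matrix_sqrt A = (THE B. sym_pos_semidef B \<and> B ** B = A)"

definition null_space :: "real^'n^'m \<Rightarrow> (real^'n) set" where
  "null_space A = {x. A *v x = 0}"


section \<open>Normal and chi-squared distributions\<close>

text \<open>Only the non-degenerate normal distribution (positive definite \<open>C\<close>) is covered; the law
  is then given by its Lebesgue density.\<close>

definition mvn_density :: "real^'n \<Rightarrow> real^'n^'n \<Rightarrow> real^'n \<Rightarrow> real" where
  "mvn_density \<mu> C x =
     exp (- ((x - \<mu>) \<bullet> (matrix_inv C *v (x - \<mu>))) / 2) / sqrt ((2 * pi) ^ CARD('n) * det C)"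

definition mv_normal :: "'w measure \<Rightarrow> ('w \<Rightarrow> real^'n) \<Rightarrow> real^'n \<Rightarrow> real^'n^'n \<Rightarrow> bool" where
  "mv_normal M Y \<mu> C \<longleftrightarrow> distributed M lborel Y (\<lambda>x. ennreal (mvn_density \<mu> C x))"

text \<open>The library's \<open>indep_var\<close> requires both random variables to have the same range type.\<close>

definition indep_rv ::
  "'w measure \<Rightarrow> ('w \<Rightarrow> 'a::topological_space) \<Rightarrow> ('w \<Rightarrow> 'b::topological_space) \<Rightarrow> bool" where
  "indep_rv M X Y \<longleftrightarrow>
     prob_space.indep_set M {X -` A \<inter> space M |A. A \<in> sets borel} {Y -` B \<inter> space M |B. B \<in> sets borel}"

text \<open>The law of the sum of \<open>Z i ^ 2\<close> over \<open>i < d\<close>, where the \<open>Z i\<close> are independent with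
  \<open>Z i\<close> normal of mean \<open>a i\<close> and variance 1. It depends on \<open>a\<close> only through the sum of the
  \<open>a i ^ 2\<close>.\<close>

definition sum_sq_normals :: "nat \<Rightarrow> (nat \<Rightarrow> real) \<Rightarrow> real measure" where
  "sum_sq_normals d a =
     distr (Pi\<^sub>M {..<d} (\<lambda>i. density lborel (\<lambda>x. ennreal (normal_density (a i) 1 x)))) borel
       (\<lambda>z. \<Sum>i<d. (z i)\<^sup>2)"

definition chi_squared :: "'w measure \<Rightarrow> ('w \<Rightarrow> real) \<Rightarrow> nat \<Rightarrow> real \<Rightarrow> bool" where
  "chi_squared M Y d c \<longleftrightarrow> Y \<in> borel_measurable M \<and>
     (\<exists>a. (\<Sum>i<d. (a i)\<^sup>2) = c \<and> distr M borel Y = sum_sq_normals d a)"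


section \<open>Generalized singular value decomposition\<close>

text \<open>The rows and columns of a matrix are indexed by finite well-ordered types; \<open>pos i\<close> is the
  1-based position of the index \<open>i\<close>. The generalized singular values \<open>\<nu>\<close>, \<open>\<mu>\<close> are used at the
  1-based positions \<open>q + 1, \<dots>, p\<close> only.\<close>

definition pos :: "'i::{finite,wellorder} \<Rightarrow> nat" where
  "pos i = card {j. j \<le> i}"

text \<open>\<open>[0 \<Upsilon>]\<close> with \<open>\<Upsilon> = diag(\<nu>\<^bsub>q+1\<^esub>, \<dots>, \<nu>\<^bsub>p\<^esub>, 1, \<dots>, 1)\<close>: the \<open>k\<close>-th diagonal entry of \<open>\<Upsilon>\<close> sits
  in column \<open>q + k\<close>.\<close>

definition gsvd_Upsilon :: "nat \<Rightarrow> nat \<Rightarrow> (nat \<Rightarrow> real) \<Rightarrow> real^'n::{finite,wellorder}^'m::{finite,wellorder}" where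
  "gsvd_Upsilon q p \<nu> =
     (\<chi> i j. if pos j = q + pos i then (if pos j \<le> p then \<nu> (pos j) else 1) else 0)"

text \<open>\<open>[M 0]\<close> with \<open>M = diag(1, \<dots>, 1, \<mu>\<^bsub>q+1\<^esub>, \<dots>, \<mu>\<^bsub>p\<^esub>)\<close>.\<close>

definition gsvd_M :: "nat \<Rightarrow> (nat \<Rightarrow> real) \<Rightarrow> real^'n::{finite,wellorder}^'p::{finite,wellorder}" where
  "gsvd_M q \<mu> =
     (\<chi> i j. if pos j = pos i then (if pos j \<le> q then 1 else \<mu> (pos j)) else 0)"

text \<open>\<open>diag(\<mu>\<^bsub>q+1\<^esub>, \<dots>, \<mu>\<^bsub>p\<^esub>, 0, \<dots>, 0)\<close>.\<close>

definition gsvd_Q :: "nat \<Rightarrow> nat \<Rightarrow> (nat \<Rightarrow> real) \<Rightarrow> real^'m::{finite,wellorder}^'m::{finite,wellorder}" where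
  "gsvd_Q q p \<mu> =
     (\<chi> i j. if i = j then (if q + pos i \<le> p then \<mu> (q + pos i) else 0) else 0)"

definition is_gsvd ::
  "real^'n::{finite,wellorder}^'m::{finite,wellorder} \<Rightarrow> real^'n::_^'p::{finite,wellorder} \<Rightarrow>
   real^'m::_^'m::_ \<Rightarrow> real^'p::_^'p::_ \<Rightarrow> real^'n::_^'n::_ \<Rightarrow> (nat \<Rightarrow> real) \<Rightarrow> (nat \<Rightarrow> real) \<Rightarrow> bool" where
  "is_gsvd A B U V X \<nu> \<mu> \<longleftrightarrow>
     (let p = CARD('p); q = CARD('n) - CARD('m) in
        orthogonal_matrix U \<and> orthogonal_matrix V \<and> invertible X \<and>
        A = U ** gsvd_Upsilon q p \<nu> ** transpose X \<and>
        B = V ** gsvd_M q \<mu> ** transpose X \<and>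
        (\<forall>i\<in>{q+1..p}. 0 < \<nu> i \<and> \<nu> i < 1 \<and> 0 < \<mu> i \<and> \<mu> i < 1 \<and> (\<nu> i)\<^sup>2 + (\<mu> i)\<^sup>2 = 1) \<and>
        (\<forall>i\<in>{q+1..p}. \<forall>j\<in>{q+1..p}. i \<le> j \<longrightarrow> \<nu> i \<le> \<nu> j \<and> \<mu> j \<le> \<mu> i))"


section \<open>The generalized Tikhonov functional\<close>

definition tik_functional ::
  "real^'m^'m \<Rightarrow> real^'n^'m \<Rightarrow> real^'p^'p \<Rightarrow> real^'n^'p \<Rightarrow> real^'m \<Rightarrow> real^'n \<Rightarrow> real^'n \<Rightarrow> real" where
  "tik_functional Wd G W L d m\<^sub>0 x =
     (norm (Wd *v (G *v x - d)))\<^sup>2 + (norm ((W ** L) *v (x - m\<^sub>0)))\<^sup>2"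

definition m_tik ::
  "real^'m^'m \<Rightarrow> real^'n^'m \<Rightarrow> real^'p^'p \<Rightarrow> real^'n^'p \<Rightarrow> real^'m \<Rightarrow> real^'n \<Rightarrow> real^'n" where
  "m_tik Wd G W L d m\<^sub>0 = (THE x. is_arg_min (tik_functional Wd G W L d m\<^sub>0) (\<lambda>_. True) x)"

end

theory Submission
  imports Defs
begin

text \<open>Write \<open>A = W\<^sub>d G\<close>, \<open>B = W\<^sub>L L\<close> and let \<open>A = U \<Upsilon> X\<^sup>T\<close>, \<open>B = V N X\<^sup>T\<close> be a generalized singular value
decomposition, where \<open>\<Upsilon>\<close> and \<open>N\<close> are the two rectangular diagonal factors. Put \<open>y = X\<^sup>T (x - m\<^sub>0)\<close> and
\<open>s = U\<^sup>T W\<^sub>d (d\<^sub>o\<^sub>b\<^sub>s - G m\<^sub>0)\<close>. Because \<open>\<Upsilon>\<^sup>T \<Upsilon> + N\<^sup>T N = I\<close> and \<open>\<Upsilon> \<Upsilon>\<^sup>T + Q\<^sup>2 = I\<close>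
(\<open>gsvd_gram_identities\<close>), completing the square turns the functional into
\<open>\<parallel>y - \<Upsilon>\<^sup>T s\<parallel>\<^sup>2 + \<parallel>Q s\<parallel>\<^sup>2\<close>. As \<open>X\<close> is invertible, the minimizer is unique and the minimum is \<open>\<parallel>Q s\<parallel>\<^sup>2\<close>
(\<open>tik_functional_arg_min\<close>).

The vector \<open>s\<close> is an affine function of the data: its mean is \<open>U\<^sup>T A (m\<^sub>h\<^sub>a\<^sub>t - m\<^sub>0)\<close>, and \<open>Q s\<close> has
covariance \<open>Q\<^sup>2 + (Q \<Upsilon>) (X\<^sup>T C\<^sub>m X) (Q \<Upsilon>)\<^sup>T\<close>. The choice of \<open>W\<^sub>L\<close> says \<open>B C\<^sub>m B\<^sup>T = I\<close>, that is
\<open>N (X\<^sup>T C\<^sub>m X) N\<^sup>T = I\<close>; since \<open>Q \<Upsilon>\<close> is a row-scaled copy of rows of \<open>N\<close> with factors \<open>\<nu>\<^sub>i\<close>, the covariance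
is diagonal with entries \<open>\<mu>\<^sub>i\<^sup>2 + \<nu>\<^sub>i\<^sup>2 = 1\<close> in the \<open>m + p - n\<close> positions where \<open>Q\<close> does not vanish. So
\<open>\<parallel>Q s\<parallel>\<^sup>2\<close> is a sum of \<open>m + p - n\<close> squares of independent unit-variance normals.

Independence is derived from the rotation invariance of the standard normal law. Noise and model are
whitened by a linear change of variables (\<open>mv_normal_whitening\<close>) and stacked into one standard normal
vector \<open>Z\<close> of dimension \<open>m + n\<close> (\<open>mv_normal_stack\<close>). The relevant entries of \<open>Q s\<close> are then constants
plus inner products of \<open>Z\<close> with orthonormal vectors, and a rotation turns such inner products into
coordinates (\<open>orthonormal_components_law\<close>).

The decomposition itself is obtained by diagonalizing \<open>A\<^sup>T A\<close> in coordinates in which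
\<open>A\<^sup>T A + B\<^sup>T B\<close> is the identity, so that \<open>B\<^sup>T B\<close> is diagonalized at the same time (\<open>gsvd_exists\<close>). This
and the uniqueness of the square root in \<open>W\<^sub>L\<close> rest on the spectral theorem for real symmetric matrices.\<close>

section \<open>Positions in a finite well-order\<close>

lemma pos_eq_iff: "pos (i::'i::{finite,wellorder}) = pos j \<longleftrightarrow> i = j"
  and pos_less_iff: "pos i < pos j \<longleftrightarrow> i < j"
proof -
  have less: "pos i < pos j" if "i < j" for i j :: 'i
  proof -
    have "{k. k \<le> i} \<subset> {k. k \<le> j}" using that by (auto simp: less_le_not_le)
    then show ?thesis unfolding pos_def by (rule psubset_card_mono[rotated]) simp
  qed
  then show "pos i < pos j \<longleftrightarrow> i < j" for i j :: 'i by (metis less_asym less_irrefl neqE)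
  then show "pos (i::'i) = pos j \<longleftrightarrow> i = j" by (metis less_irrefl neqE)
qed

lemma pos_bounds: "1 \<le> pos (i::'i::{finite,wellorder})" "pos i \<le> CARD('i)"
proof -
  have "{j. j \<le> i} \<noteq> {}" by auto
  then show "1 \<le> pos i" by (simp add: pos_def Suc_le_eq card_gt_0_iff)
  show "pos i \<le> CARD('i)" unfolding pos_def by (rule card_mono) auto
qed

lemma bij_betw_pos: "bij_betw (pos :: 'i::{finite,wellorder} \<Rightarrow> nat) UNIV {1..CARD('i)}"
proof -
  have inj: "inj (pos :: 'i \<Rightarrow> nat)" by (simp add: inj_def pos_eq_iff)
  have "pos ` (UNIV :: 'i set) = {1..CARD('i)}"
    by (rule card_subset_eq) (use pos_bounds in \<open>auto simp: card_image[OF inj]\<close>)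
  then show ?thesis using inj by (simp add: bij_betw_def)
qed

lemma pos_surj:
  assumes "1 \<le> k" "k \<le> CARD('i)"
  obtains i :: "'i::{finite,wellorder}" where "pos i = k"
  using bij_betw_pos[where 'i='i] assms by (auto simp: bij_betw_def) (metis (mono_tags, lifting) atLeastAtMost_iff imageE One_nat_def)

text \<open>The eigenvalues of the spectral decomposition have to be weakly increasing along the index type for the
ordering of the generalized singular values; this supplies the enumeration.\<close>

lemma finite_sorted_enumeration:
  fixes d :: "'a \<Rightarrow> real"
  assumes "finite B" "card B = CARD('i)"
  obtains f :: "'i::{finite,wellorder} \<Rightarrow> 'a" where "bij_betw f UNIV B" "\<And>i j. i \<le> j \<Longrightarrow> d (f i) \<le> d (f j)"
proof -
  obtain ys where ys: "set ys = B" "distinct ys" using assms(1) finite_distinct_list by blast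
  define xs where "xs = sort_key d ys"
  have xs: "set xs = B" "distinct xs" "sorted (map d xs)" using ys by (auto simp: xs_def)
  have len: "length xs = CARD('i)" using xs assms(2) distinct_card by metis
  define f :: "'i \<Rightarrow> 'a" where "f i = xs ! (pos i - 1)" for i
  have lt: "pos i - 1 < length xs" for i :: 'i using pos_bounds[of i] len by simp
  have "inj f" unfolding inj_def f_def
    using xs(2) lt pos_bounds(1) by (metis nth_eq_iff_index_eq pos_eq_iff le_add_diff_inverse)
  moreover have "f ` UNIV \<subseteq> B" using lt xs(1) by (auto simp: f_def)
  ultimately have "bij_betw f UNIV B"
    by (metis assms bij_betw_def card_image card_subset_eq)
  moreover have "d (f i) \<le> d (f j)" if "i \<le> j" for i j
  proof -
    have "pos i \<le> pos j" using that pos_less_iff by (metis not_less)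
    then show ?thesis
      using sorted_nth_mono[OF xs(3), of "pos i - 1" "pos j - 1"] lt by (simp add: f_def)
  qed
  ultimately show ?thesis using that by blast
qed

text \<open>For sorted values \<open>0 \<le> d j \<le> 1\<close> the sets \<open>{j. d j = 0}\<close> and \<open>{j. d j \<noteq> 1}\<close> are downward closed, so it is
enough to count their elements, and the counts are determined by ranks.\<close>

lemma downward_closed_eq_pos:
  fixes J :: "'n::{finite,wellorder} set"
  assumes "\<And>i j. i \<le> j \<Longrightarrow> j \<in> J \<Longrightarrow> i \<in> J"
  shows "J = {j. pos j \<le> card J}"
proof (cases "J = {}")
  case True
  then show ?thesis using pos_bounds(1) by (auto simp: not_le Suc_le_eq)
next
  case False
  then have "Max J \<in> J" by simp
  have J: "j \<in> J \<longleftrightarrow> j \<le> Max J" for j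
  proof
    show "j \<le> Max J" if "j \<in> J" using that by (intro Max_ge) auto
    show "j \<in> J" if "j \<le> Max J" using that \<open>Max J \<in> J\<close> by (rule assms)
  qed
  have "card J = card {j. j \<le> Max J}" by (rule arg_cong[where f = card]) (use J in blast)
  then have "card J = pos (Max J)" unfolding pos_def .
  moreover have "i \<le> j \<longleftrightarrow> pos i \<le> pos j" for i j :: 'n by (metis not_less pos_less_iff)
  ultimately show ?thesis using J by (intro set_eqI) (simp only: mem_Collect_eq)
qed

text \<open>The map \<open>e\<close> sends a row of a rectangular diagonal factor to the column of its entry: \<open>q = n - m\<close> for
\<open>\<Upsilon>\<close>, and \<open>q = 0\<close> for the other one.\<close>

lemma pos_shift_ex:
  assumes "q + CARD('m) \<le> CARD('n)"
  obtains e :: "'m::{finite,wellorder} \<Rightarrow> 'n::{finite,wellorder}" where "\<And>i. pos (e i) = q + pos i"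
proof -
  have "\<exists>j::'n. pos j = q + pos i" for i :: 'm
  proof -
    have "1 \<le> q + pos i" "q + pos i \<le> CARD('n)" using pos_bounds[of i] assms by linarith+
    then obtain j :: 'n where "pos j = q + pos i" by (rule pos_surj)
    then show ?thesis ..
  qed
  then show ?thesis using that by metis
qed

lemma pos_shift_range:
  fixes e :: "'m::{finite,wellorder} \<Rightarrow> 'n::{finite,wellorder}"
  assumes "\<And>i. pos (e i) = q + pos i"
  shows "inj e" "range e = {j. q < pos j \<and> pos j \<le> q + CARD('m)}"
proof -
  show "inj e" by (rule injI) (metis add_left_cancel assms pos_eq_iff)
  have "j \<in> range e" if j: "q < pos j" "pos j \<le> q + CARD('m)" for j
  proof -
    have "1 \<le> pos j - q" "pos j - q \<le> CARD('m)" using j by linarith+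
    then obtain i :: 'm where "pos i = pos j - q" by (rule pos_surj)
    then have "pos (e i) = pos j" unfolding assms using j(1) by simp
    then have "j = e i" by (simp only: pos_eq_iff)
    then show ?thesis by auto
  qed
  moreover have "q < pos (e i) \<and> pos (e i) \<le> q + CARD('m)" for i
    unfolding assms using pos_bounds[of i] by linarith
  ultimately show "range e = {j. q < pos j \<and> pos j \<le> q + CARD('m)}" by blast
qed

section \<open>Spectral theorem for real symmetric matrices\<close>

definition diag_mat :: "('n \<Rightarrow> real) \<Rightarrow> real^'n^'n" where
  "diag_mat d = (\<chi> i j. if i = j then d i else 0)"

lemma diag_mat_mult: "diag_mat a ** diag_mat b = diag_mat (\<lambda>i. a i * b i)"
  by (simp add: diag_mat_def matrix_matrix_mult_def vec_eq_iff mult_delta_left mult_delta_right)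

lemma transpose_diag_mat [simp]: "transpose (diag_mat d) = diag_mat d"
  by (auto simp: diag_mat_def transpose_def vec_eq_iff)

lemma diag_mat_one: "diag_mat (\<lambda>_. 1) = mat 1"
  by (simp add: diag_mat_def mat_def)

lemma column_matrix_mult: "column k (A ** B) = A *v column k B"
  by (simp add: column_def matrix_matrix_mult_def matrix_vector_mult_def vec_eq_iff)

lemma matrix_eq_columns: "(\<And>k. column k A = column k B) \<Longrightarrow> A = B"
  by (simp add: column_def vec_eq_iff)

lemma column_diag_mat_mult: "column i (P ** diag_mat d) = d i *\<^sub>R column i P"
  by (simp add: column_def matrix_matrix_mult_def diag_mat_def vec_eq_iff mult_delta_left mult_delta_right)

lemma inner_matrix_symmetric:
  fixes A :: "real^'n^'n"
  assumes "transpose A = A"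
  shows "x \<bullet> (A *v y) = (A *v x) \<bullet> y"
  using dot_lmul_matrix[of x A y] assms by (metis transpose_matrix_vector)

text \<open>A maximizer \<open>v\<close> of \<open>x \<bullet> A x\<close> over the unit sphere of the subspace, with maximum \<open>c\<close>, is an eigenvector: the
form \<open>c (x \<bullet> x) - x \<bullet> A x\<close> is nonnegative on the subspace and vanishes at \<open>v\<close>.\<close>

lemma symmetric_eigenvector_in_subspace:
  fixes A :: "real^'n^'n"
  assumes sym: "transpose A = A" and S: "subspace S" and inv: "\<And>x. x \<in> S \<Longrightarrow> A *v x \<in> S"
    and ne: "z \<in> S" "z \<noteq> 0"
  obtains v c where "v \<in> S" "norm v = 1" "A *v v = c *\<^sub>R v"
proof -
  let ?K = "S \<inter> sphere 0 1"
  have "compact ?K"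
    by (metis S closed_Int_compact closed_subspace compact_sphere)
  moreover have "z /\<^sub>R norm z \<in> ?K" using ne S by (auto simp: subspace_scale)
  moreover have "continuous_on ?K (\<lambda>x. x \<bullet> (A *v x))"
    by (intro continuous_intros linear_continuous_on linear_linear[THEN iffD2]) simp
  ultimately obtain v where v: "v \<in> ?K" and max: "\<And>y. y \<in> ?K \<Longrightarrow> y \<bullet> (A *v y) \<le> v \<bullet> (A *v v)"
    using continuous_attains_sup[of ?K "\<lambda>x. x \<bullet> (A *v x)"] by blast
  define c where "c = v \<bullet> (A *v v)"
  define w where "w = c *\<^sub>R v - A *v v"
  have vS: "v \<in> S" "v \<bullet> v = 1" using v by (auto simp: norm_eq_1)
  have wS: "w \<in> S" unfolding w_def using S vS inv by (simp add: subspace_diff subspace_scale)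
  have nonneg: "0 \<le> c * (x \<bullet> x) - x \<bullet> (A *v x)" if "x \<in> S" for x
  proof (cases "x = 0")
    case False
    define u where "u = x /\<^sub>R norm x"
    have x: "x = norm x *\<^sub>R u" using False by (simp add: u_def)
    have "u \<in> ?K" using that S False by (auto simp: u_def subspace_scale)
    from max[OF this] have "(norm x)\<^sup>2 * (u \<bullet> (A *v u)) \<le> (norm x)\<^sup>2 * c"
      unfolding c_def by (rule mult_left_mono) simp
    moreover have "x \<bullet> (A *v x) = (norm x)\<^sup>2 * (u \<bullet> (A *v u))"
      by (subst (1 2) x) (simp add: matrix_vector_mult_scaleR power2_eq_square)
    ultimately show ?thesis by (simp add: power2_norm_eq_inner mult.commute[of c])
  qed simp
  have vw: "v \<bullet> (A *v w) = w \<bullet> (A *v v)"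
    using inner_matrix_symmetric[OF sym] by (metis inner_commute)
  \<comment> \<open>The nonnegative quadratic form vanishes at \<open>v\<close>, so its first-order term along \<open>w\<close>, which is
    \<open>2 t (w \<bullet> w)\<close>, vanishes as well.\<close>
  have quad: "0 \<le> 2 * t * (w \<bullet> w) + t\<^sup>2 * (c * (w \<bullet> w) - w \<bullet> (A *v w))" for t
  proof -
    have "v + t *\<^sub>R w \<in> S" using S vS wS by (simp add: subspace_add subspace_scale)
    note nn = nonneg[OF this]
    have 1: "(v + t *\<^sub>R w) \<bullet> (A *v (v + t *\<^sub>R w)) =
        v \<bullet> (A *v v) + 2 * t * (w \<bullet> (A *v v)) + t\<^sup>2 * (w \<bullet> (A *v w))"
      by (simp add: matrix_vector_right_distrib matrix_vector_mult_scaleR inner_add_left inner_add_right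
          vw power2_eq_square distrib_left)
    have 2: "(v + t *\<^sub>R w) \<bullet> (v + t *\<^sub>R w) = v \<bullet> v + 2 * t * (w \<bullet> v) + t\<^sup>2 * (w \<bullet> w)"
      by (simp add: inner_add_left inner_add_right inner_commute[of v w] power2_eq_square distrib_left)
    have "0 \<le> c * (v \<bullet> v) - v \<bullet> (A *v v) + 2 * t * (c * (w \<bullet> v) - w \<bullet> (A *v v))
        + t\<^sup>2 * (c * (w \<bullet> w) - w \<bullet> (A *v w))"
      using nn unfolding 1 2 by (simp add: algebra_simps)
    moreover have "c * (w \<bullet> v) - w \<bullet> (A *v v) = w \<bullet> w"
      unfolding w_def by (simp only: inner_diff_right inner_scaleR_right)
    ultimately show ?thesis using vS by (simp add: c_def)
  qed
  define k where "k = c * (w \<bullet> w) - w \<bullet> (A *v w)"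
  have k: "0 \<le> k" using nonneg[OF wS] by (simp add: k_def)
  have "w \<bullet> w = 0"
  proof (rule ccontr)
    assume "w \<bullet> w \<noteq> 0"
    then have pos: "w \<bullet> w > 0" by (simp add: order_less_le)
    \<comment> \<open>The summand \<open>1\<close> keeps the denominator positive when the quadratic coefficient \<open>k\<close> is \<open>0\<close>.\<close>
    define t where "t = - (w \<bullet> w) / (k + 1)"
    have t: "t * (k + 1) = - (w \<bullet> w)" "t < 0" using k pos by (simp_all add: t_def)
    have "0 \<le> 2 * t * (w \<bullet> w) + t\<^sup>2 * k" using quad[of t] by (simp add: k_def)
    also have "\<dots> \<le> 2 * t * (w \<bullet> w) + t * (t * (k + 1))"
      by (simp add: power2_eq_square algebra_simps)
    also have "\<dots> = t * (w \<bullet> w)" unfolding t(1) by simp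
    finally have "0 \<le> t * (w \<bullet> w)" .
    moreover have "t * (w \<bullet> w) < 0" using t(2) pos by (rule mult_neg_pos)
    ultimately show False by simp
  qed
  then have "A *v v = c *\<^sub>R v" by (simp add: w_def)
  then show ?thesis using vS by (intro that[of v c]) (auto simp: norm_eq_1)
qed

text \<open>An orthonormal set of eigenvectors of maximal size is a basis, since otherwise its orthogonal complement
is a nonzero invariant subspace and contributes another eigenvector.\<close>

lemma symmetric_orthonormal_eigenbasis:
  fixes A :: "real^'n^'n"
  assumes sym: "transpose A = A"
  obtains B :: "(real^'n) set" where "card B = CARD('n)" "pairwise orthogonal B"
    "\<And>v. v \<in> B \<Longrightarrow> norm v = 1" "\<And>v. v \<in> B \<Longrightarrow> \<exists>c. A *v v = c *\<^sub>R v"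
proof -
  define good where
    "good B \<longleftrightarrow> pairwise orthogonal B \<and> (\<forall>v\<in>B. norm v = 1 \<and> (\<exists>c. A *v v = c *\<^sub>R v))" for B
  have indep: "independent B" if "good B" for B
    using that unfolding good_def by (intro pairwise_orthogonal_independent) auto
  have bound: "card B \<le> CARD('n)" if "good B" for B
    using independent_bound[OF indep[OF that]] by simp
  have "\<exists>B. good B \<and> (\<forall>C. good C \<longrightarrow> card C \<le> card B)"
  proof (rule ex_has_greatest_nat[where b = "Suc CARD('n)"])
    show "good {}" by (simp add: good_def)
    show "\<forall>B. good B \<longrightarrow> card B < Suc CARD('n)"
      using bound le_imp_less_Suc by (intro allI impI) blast
  qed
  then obtain B where gB: "good B" and max: "\<And>C. good C \<Longrightarrow> card C \<le> card B" by blast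
  note B = gB[unfolded good_def]
  have fin: "finite B" using indep[OF gB] by (rule independent_imp_finite)
  have "card B = CARD('n)"
  proof (rule ccontr)
    assume "card B \<noteq> CARD('n)"
    then have "card B < CARD('n)" using bound[OF gB] by simp
    then have "dim B < DIM(real^'n)" using dim_le_card'[OF fin] by simp
    then obtain z where z: "z \<noteq> 0" "\<And>y. y \<in> span B \<Longrightarrow> orthogonal z y"
      by (rule orthogonal_to_subspace_exists) blast
    define S where "S = {x. \<forall>b\<in>B. b \<bullet> x = 0}"
    have S: "subspace S" unfolding S_def by (auto simp: subspace_def inner_simps)
    have inv: "A *v x \<in> S" if "x \<in> S" for x
    proof -
      have "b \<bullet> (A *v x) = 0" if "b \<in> B" for b
        using B \<open>x \<in> S\<close> that inner_matrix_symmetric[OF sym, of b x] by (auto simp: S_def)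
      then show ?thesis by (simp add: S_def)
    qed
    have zS: "z \<in> S" using z(2) by (auto simp: S_def orthogonal_def span_base inner_commute[of _ z])
    obtain v c where v: "v \<in> S" "norm v = 1" "A *v v = c *\<^sub>R v"
      using symmetric_eigenvector_in_subspace[OF sym S inv zS z(1)] by blast
    have "v \<notin> B" using v by (auto simp: S_def norm_eq_1)
    have "pairwise orthogonal (insert v B)"
      unfolding pairwise_insert using B v(1) by (simp add: S_def orthogonal_def inner_commute[of v])
    then have ins: "good (insert v B)" using B v(2,3) unfolding good_def by blast
    then show False using \<open>v \<notin> B\<close> max[OF ins] fin by simp
  qed
  then show ?thesis using that B by blast
qed

lemma symmetric_spectral_decomposition:
  fixes A :: "real^'n::{finite,wellorder}^'n::_"
  assumes sym: "transpose A = A"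
  obtains P d where "orthogonal_matrix P" "A = P ** diag_mat d ** transpose P"
    "\<And>i j. i \<le> j \<Longrightarrow> d i \<le> d j"
proof -
  obtain B :: "(real^'n::_) set" where B: "card B = CARD('n)" "pairwise orthogonal B"
    "\<And>v. v \<in> B \<Longrightarrow> norm v = 1" "\<And>v. v \<in> B \<Longrightarrow> \<exists>c. A *v v = c *\<^sub>R v"
    using symmetric_orthonormal_eigenbasis[OF sym] by metis
  then obtain e where e: "\<And>v. v \<in> B \<Longrightarrow> A *v v = e v *\<^sub>R v" by metis
  have "finite B" using B(1) by (metis card.infinite zero_less_card_finite less_irrefl)
  then obtain f :: "'n \<Rightarrow> real^'n::_" where f: "bij_betw f UNIV B" "\<And>i j. i \<le> j \<Longrightarrow> e (f i) \<le> e (f j)"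
    using finite_sorted_enumeration[of B e] B(1) by metis
  define P :: "real^'n::_^'n::_" where "P = (\<chi> i j. f j $ i)"
  have col: "column j P = f j" for j by (simp add: P_def column_def vec_eq_iff)
  have fB: "f j \<in> B" for j using f(1) by (auto simp: bij_betw_def)
  have inj: "f i = f j \<longleftrightarrow> i = j" for i j using f(1) by (auto simp: bij_betw_def inj_def)
  have P: "orthogonal_matrix P"
    unfolding orthogonal_matrix_orthonormal_columns col
  proof (intro conjI allI impI)
    show "norm (f i) = 1" for i using B(3)[OF fB] .
    show "orthogonal (f i) (f j)" if "i \<noteq> j" for i j
      using pairwiseD[OF B(2) fB fB] inj that by simp
  qed
  have "column j (A ** P) = column j (P ** diag_mat (\<lambda>i. e (f i)))" for j
    by (simp only: column_matrix_mult[of j A P] column_diag_mat_mult col e[OF fB])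
  then have "A ** P = P ** diag_mat (\<lambda>i. e (f i))" by (rule matrix_eq_columns)
  then have "A ** P ** transpose P = P ** diag_mat (\<lambda>i. e (f i)) ** transpose P" by simp
  moreover have "A ** P ** transpose P = A"
    using P by (simp add: matrix_mul_assoc[symmetric] orthogonal_matrix_def)
  ultimately have "A = P ** diag_mat (\<lambda>i. e (f i)) ** transpose P" by simp
  then show ?thesis using f(2) that P by blast
qed

section \<open>Positive definite matrices and their square roots\<close>

lemma matrix_mult_add_rdistrib:
  fixes A B :: "real^'n^'m"
  shows "(A + B) ** C = A ** C + B ** C"
  by (simp add: matrix_matrix_mult_def vec_eq_iff distrib_right sum.distrib)

lemma inner_transpose_mult:
  fixes A :: "real^'n^'m" and B :: "real^'k^'m"
  shows "(A *v x) \<bullet> (B *v y) = x \<bullet> ((transpose A ** B) *v y)"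
  by (metis dot_lmul_matrix matrix_vector_mul_assoc transpose_matrix_vector transpose_transpose)

lemma orthogonal_matrix_cancel:
  assumes "orthogonal_matrix (P :: real^'n^'n)"
  shows "transpose P ** (P ** A) = A" "P ** (transpose P ** B) = B"
  using assms by (simp_all add: matrix_mul_assoc orthogonal_matrix_def)

lemma diagonalization_eigenvector:
  fixes A :: "real^'n^'n"
  assumes "orthogonal_matrix P" "A = P ** diag_mat d ** transpose P"
  shows "A *v column i P = d i *\<^sub>R column i P" "column i P \<bullet> column i P = 1"
    "column i P \<noteq> 0" "d i = column i P \<bullet> (A *v column i P)"
proof -
  have "A ** P = P ** diag_mat d"
    using assms by (simp add: matrix_mul_assoc[symmetric] orthogonal_matrix_def)
  then show *: "A *v column i P = d i *\<^sub>R column i P"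
    by (metis column_matrix_mult column_diag_mat_mult)
  show **: "column i P \<bullet> column i P = 1"
    using assms(1) by (simp add: orthogonal_matrix_orthonormal_columns norm_eq_1)
  then show "column i P \<noteq> 0" by auto
  show "d i = column i P \<bullet> (A *v column i P)" by (simp add: * **)
qed

lemma sym_pos_def_imp_semidef: "sym_pos_def A \<Longrightarrow> sym_pos_semidef A"
  unfolding sym_pos_def_def sym_pos_semidef_def by (metis inner_zero_left order.order_iff_strict)

lemma sym_pos_def_invertible:
  assumes "sym_pos_def A" shows "invertible A"
proof -
  have "x = 0" if "A *v x = 0" for x
    using assms that unfolding sym_pos_def_def by (metis inner_zero_right less_irrefl)
  then show ?thesis by (metis invertible_left_inverse matrix_left_invertible_ker)
qed

lemma matrix_inv_cancel:
  assumes "invertible (A :: real^'n^'n)"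
  shows "A ** matrix_inv A = mat 1" "matrix_inv A ** A = mat 1"
  using someI_ex[OF assms[unfolded invertible_def]] unfolding matrix_inv_def by auto

lemma matrix_inv_eqI:
  fixes A B :: "real^'n^'n"
  assumes "A ** B = mat 1" shows "matrix_inv A = B"
proof -
  have "invertible A" using assms invertible_right_inverse by blast
  then show ?thesis by (metis assms matrix_inv_cancel(2) matrix_mul_assoc matrix_mul_lid matrix_mul_rid)
qed

lemma sym_pos_def_matrix_inv:
  assumes "sym_pos_def A" shows "sym_pos_def (matrix_inv A)"
proof -
  note inv = matrix_inv_cancel[OF sym_pos_def_invertible[OF assms]]
  have sym: "transpose A = A" using assms by (simp add: sym_pos_def_def)
  have "A ** transpose (matrix_inv A) = mat 1"
    by (metis inv(2) matrix_transpose_mul sym transpose_mat)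
  then have "transpose (matrix_inv A) = matrix_inv A" using matrix_inv_eqI by metis
  moreover have "0 < x \<bullet> (matrix_inv A *v x)" if "x \<noteq> 0" for x
  proof -
    let ?y = "matrix_inv A *v x"
    have x: "x = A *v ?y" by (simp add: matrix_vector_mul_assoc inv)
    then have "?y \<noteq> 0" using that by auto
    then have "0 < ?y \<bullet> (A *v ?y)" using assms by (simp add: sym_pos_def_def)
    then show ?thesis using x by (simp add: inner_commute)
  qed
  ultimately show ?thesis by (simp add: sym_pos_def_def)
qed

lemma psd_sqrt_exists:
  fixes A :: "real^'n::{finite,wellorder}^'n::_"
  assumes "sym_pos_semidef A"
  shows "\<exists>B. sym_pos_semidef B \<and> B ** B = A"
proof -
  obtain P d where P: "orthogonal_matrix P" "A = P ** diag_mat d ** transpose P"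
    using symmetric_spectral_decomposition assms unfolding sym_pos_semidef_def by metis
  have d: "d i \<ge> 0" for i
    using diagonalization_eigenvector(4)[OF P, of i] assms by (simp add: sym_pos_semidef_def)
  define B where "B = P ** diag_mat (\<lambda>i. sqrt (d i)) ** transpose P"
  have "B ** B = P ** (diag_mat (\<lambda>i. sqrt (d i)) ** diag_mat (\<lambda>i. sqrt (d i))) ** transpose P"
    unfolding B_def by (simp add: matrix_mul_assoc[symmetric] orthogonal_matrix_cancel[OF P(1)])
  then have "B ** B = A" using d by (simp add: diag_mat_mult P(2))
  moreover have "transpose B = B"
    by (simp add: B_def matrix_transpose_mul matrix_mul_assoc)
  moreover have "0 \<le> x \<bullet> (B *v x)" for x
  proof -
    let ?y = "transpose P *v x"
    have "x \<bullet> (B *v x) = ?y \<bullet> (diag_mat (\<lambda>i. sqrt (d i)) *v ?y)"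
      by (simp add: B_def matrix_vector_mul_assoc[symmetric] dot_lmul_matrix[symmetric])
    also have "\<dots> = (\<Sum>i\<in>UNIV. sqrt (d i) * (?y $ i)\<^sup>2)"
      by (simp add: inner_vec_def diag_mat_def matrix_vector_mult_def mult_delta_left mult_delta_right
          power2_eq_square algebra_simps)
    finally show ?thesis using d by (simp add: sum_nonneg)
  qed
  ultimately show ?thesis unfolding sym_pos_semidef_def by blast
qed

text \<open>If \<open>B v = d v\<close> with \<open>d > 0\<close>, then \<open>(C + d) (C - d) v = (C\<^sup>2 - B\<^sup>2) v = 0\<close> and \<open>C + d\<close> is injective;
if \<open>d = 0\<close>, then \<open>C\<^sup>2 v = 0\<close> and so \<open>C v = 0\<close>. Hence \<open>C\<close> agrees with \<open>B\<close> on an eigenbasis of \<open>B\<close>.\<close>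

lemma psd_sqrt_unique:
  fixes B C :: "real^'n::{finite,wellorder}^'n::_"
  assumes B: "sym_pos_semidef B" and C: "sym_pos_semidef C" and eq: "B ** B = C ** C"
  shows "B = C"
proof -
  obtain P d where P: "orthogonal_matrix P" "B = P ** diag_mat d ** transpose P"
    using symmetric_spectral_decomposition B unfolding sym_pos_semidef_def by metis
  have "column i (B ** P) = column i (C ** P)" for i
  proof -
    define v where "v = column i P"
    have Bv: "B *v v = d i *\<^sub>R v" and d: "d i \<ge> 0"
      using diagonalization_eigenvector[OF P, of i] B by (simp_all add: v_def sym_pos_semidef_def)
    have CC: "C *v (C *v v) = (d i)\<^sup>2 *\<^sub>R v"
    proof -
      have "C *v (C *v v) = B *v (B *v v)" by (simp add: matrix_vector_mul_assoc eq)
      then show ?thesis by (simp add: Bv matrix_vector_mult_scaleR power2_eq_square)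
    qed
    have "C *v v = d i *\<^sub>R v"
    proof (cases "d i = 0")
      case True
      have "(C *v v) \<bullet> (C *v v) = v \<bullet> (C *v (C *v v))"
        using C inner_matrix_symmetric unfolding sym_pos_semidef_def by metis
      then show ?thesis using True CC by simp
    next
      case False
      define u where "u = C *v v - d i *\<^sub>R v"
      have "C *v u + d i *\<^sub>R u = 0"
        by (simp add: u_def matrix_vector_mult_diff_distrib CC matrix_vector_mult_scaleR
            algebra_simps power2_eq_square)
      then have "u \<bullet> (C *v u) + d i * (u \<bullet> u) = 0"
        by (metis inner_add_right inner_scaleR_right inner_zero_right)
      moreover have "0 \<le> u \<bullet> (C *v u)" using C by (simp add: sym_pos_semidef_def)
      moreover have "0 \<le> d i * (u \<bullet> u)" using d by simp
      ultimately have "d i * (u \<bullet> u) = 0" by linarith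
      then show ?thesis using False by (simp add: u_def)
    qed
    then show ?thesis using Bv by (simp add: column_matrix_mult v_def)
  qed
  then have "B ** P = C ** P" by (rule matrix_eq_columns)
  then have "B ** P ** transpose P = C ** P ** transpose P" by simp
  then show ?thesis using P(1) by (simp add: matrix_mul_assoc[symmetric] orthogonal_matrix_def)
qed

lemma matrix_sqrt_properties:
  fixes A :: "real^'n::{finite,wellorder}^'n::_"
  assumes "sym_pos_semidef A"
  shows "sym_pos_semidef (matrix_sqrt A)" "matrix_sqrt A ** matrix_sqrt A = A"
proof -
  have "\<exists>!B. sym_pos_semidef B \<and> B ** B = A"
    using psd_sqrt_exists[OF assms] psd_sqrt_unique by metis
  from theI'[OF this, folded matrix_sqrt_def]
  show "sym_pos_semidef (matrix_sqrt A)" "matrix_sqrt A ** matrix_sqrt A = A" by simp_all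
qed

lemma sym_pos_def_whitening:
  fixes C :: "real^'n::{finite,wellorder}^'n::_"
  assumes "sym_pos_def C"
  obtains S :: "real^'n::_^'n::_" where "invertible S" "transpose S ** C ** S = mat 1"
proof -
  obtain P d where P: "orthogonal_matrix P" "C = P ** diag_mat d ** transpose P"
    using symmetric_spectral_decomposition assms unfolding sym_pos_def_def by metis
  have d: "d i > 0" for i
    using diagonalization_eigenvector(3,4)[OF P, of i] assms by (simp add: sym_pos_def_def)
  define S where "S = P ** diag_mat (\<lambda>i. 1 / sqrt (d i))"
  have "transpose S ** C ** S =
      diag_mat (\<lambda>i. 1 / sqrt (d i)) ** (diag_mat d ** diag_mat (\<lambda>i. 1 / sqrt (d i)))"
    unfolding S_def P(2)
    by (simp add: matrix_transpose_mul matrix_mul_assoc[symmetric] orthogonal_matrix_cancel[OF P(1)])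
  also have "\<dots> = mat 1" using d
    by (simp add: diag_mat_mult less_imp_neq[symmetric] less_imp_le flip: diag_mat_one)
  finally have 1: "transpose S ** C ** S = mat 1" .
  then have "invertible S" using invertible_left_inverse by blast
  then show ?thesis using 1 that by blast
qed

section \<open>Existence of the generalized singular value decomposition\<close>

text \<open>The common shape of the two rectangular diagonal factors of the decomposition: one possibly nonzero
entry per row, in column \<open>e i\<close> of row \<open>i\<close>.\<close>

definition sel_mat :: "('m \<Rightarrow> 'n) \<Rightarrow> ('n \<Rightarrow> real) \<Rightarrow> real^'n^'m" where
  "sel_mat e c = (\<chi> i j. if j = e i then c j else 0)"

lemma sel_mat_mult_transpose:
  fixes e :: "'m::finite \<Rightarrow> 'n::finite"
  assumes "inj e"
  shows "sel_mat e c ** transpose (sel_mat e c) = diag_mat (\<lambda>i. (c (e i))\<^sup>2)"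
  using assms
  by (simp add: sel_mat_def diag_mat_def matrix_matrix_mult_def transpose_def vec_eq_iff mult_delta_left
      mult_delta_right power2_eq_square inj_eq)

lemma transpose_sel_mat_mult:
  fixes e :: "'m::finite \<Rightarrow> 'n::finite"
  assumes "inj e"
  shows "transpose (sel_mat e c) ** sel_mat e c = diag_mat (\<lambda>j. if j \<in> range e then (c j)\<^sup>2 else 0)"
proof -
  have "(\<Sum>i\<in>UNIV. (if j = e i then c j else 0) * (if k = e i then c k else 0)) =
      (if j = k then if j \<in> range e then (c j)\<^sup>2 else 0 else 0)" for j k
  proof (cases "j = k \<and> j \<in> range e")
    case True
    then obtain i0 where i0: "j = e i0" "k = e i0" by auto
    then have "(\<Sum>i\<in>UNIV. (if j = e i then c j else 0) * (if k = e i then c k else 0)) =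
        (\<Sum>i\<in>UNIV. if i = i0 then (c j)\<^sup>2 else 0)"
      using assms by (intro sum.cong) (auto simp: inj_eq power2_eq_square)
    then show ?thesis using i0 by simp
  next
    case False
    then show ?thesis by (auto intro!: sum.neutral)
  qed
  then show ?thesis
    by (simp add: sel_mat_def diag_mat_def matrix_matrix_mult_def transpose_def vec_eq_iff)
qed

lemma orthogonal_columns_nonneg:
  fixes F :: "real^'n^'m"
  assumes "transpose F ** F = diag_mat d"
  shows "column i F \<bullet> column j F = (if i = j then d i else 0)" "d i \<ge> 0" "d i = 0 \<longleftrightarrow> column i F = 0"
proof -
  show *: "column i F \<bullet> column j F = (if i = j then d i else 0)" for i j
  proof -
    have "(transpose F ** F) $ i $ j = column i F \<bullet> column j F"
      by (simp add: matrix_matrix_mult_def transpose_def column_def inner_vec_def)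
    then show ?thesis using assms by (simp add: diag_mat_def)
  qed
  show "d i \<ge> 0" "d i = 0 \<longleftrightarrow> column i F = 0"
    using *[of i i] by (metis inner_ge_zero, metis inner_eq_zero_iff)
qed

text \<open>The nonzero columns are orthogonal, hence independent, and they span the column space.\<close>

lemma rank_orthogonal_columns:
  fixes F :: "real^'n^'m"
  assumes F: "transpose F ** F = diag_mat d"
  shows "card {j. d j \<noteq> 0} = rank F"
proof -
  let ?J = "{j. d j \<noteq> 0}" and ?c = "\<lambda>j. column j F"
  note o = orthogonal_columns_nonneg[OF F]
  have inj: "inj_on ?c ?J"
  proof (rule inj_onI)
    fix i j assume "i \<in> ?J" "?c i = ?c j"
    then show "i = j" using o(1)[of i j] o(1)[of i i] by (auto split: if_splits)
  qed
  have orth: "pairwise orthogonal (?c ` ?J)"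
  proof (rule pairwise_imageI)
    show "orthogonal (?c i) (?c j)" if "i \<noteq> j" for i j
      using o(1)[of i j] that by (simp add: orthogonal_def)
  qed
  have "0 \<notin> ?c ` ?J" using o(3) by (metis (mono_tags, lifting) imageE mem_Collect_eq)
  with orth have ind: "independent (?c ` ?J)" by (rule pairwise_orthogonal_independent)
  have "columns F = range ?c" by (auto simp: columns_def)
  then have "insert 0 (columns F) = insert 0 (?c ` ?J)" using o(3)[symmetric] by auto
  then have "span (columns F) = span (?c ` ?J)" by (metis span_insert_0)
  then have "dim (columns F) = card (?c ` ?J)" by (metis dim_span dim_eq_card_independent ind)
  then show ?thesis using card_image[OF inj] by (simp add: column_rank_def)
qed

text \<open>A singular value decomposition without right factor: the columns of \<open>U\<close> are the nonzero columns of
\<open>F\<close>, normalized. There are as many of them as rows of \<open>F\<close>, so \<open>U\<close> is square and therefore orthogonal.\<close>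

lemma orthogonal_columns_factorization:
  fixes F :: "real^'n^'m"
  assumes F: "transpose F ** F = diag_mat d" and e: "inj e" "range e = {j. d j \<noteq> 0}"
  obtains U :: "real^'m^'m" where "orthogonal_matrix U" "F = U ** sel_mat e (\<lambda>j. sqrt (d j))"
proof -
  note o = orthogonal_columns_nonneg[OF F]
  define U :: "real^'m^'m" where "U = (\<chi> k i. F $ k $ e i / sqrt (d (e i)))"
  have pos: "d (e i) > 0" for i
    using e(2) o(2)[of "e i"] by (metis (mono_tags, lifting) less_eq_real_def mem_Collect_eq rangeI)
  have col: "column i U = (1 / sqrt (d (e i))) *\<^sub>R column (e i) F" for i
    by (simp add: U_def column_def vec_eq_iff)
  have "column i U \<bullet> column j U = (if i = j then 1 else 0)" for i j
    using pos[of i] e(1) by (auto simp: col o(1) inj_eq)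
  then have "orthogonal_matrix U"
    by (simp add: orthogonal_matrix_orthonormal_columns norm_eq_1 orthogonal_def)
  moreover have "F $ k $ j = (U ** sel_mat e (\<lambda>j. sqrt (d j))) $ k $ j" for k j
  proof (cases "j \<in> range e")
    case True
    then obtain i0 where i0: "j = e i0" by auto
    have "(U ** sel_mat e (\<lambda>j. sqrt (d j))) $ k $ j = (\<Sum>i\<in>UNIV. if i = i0 then F $ k $ j else 0)"
    proof -
      have "U $ k $ i * sel_mat e (\<lambda>j. sqrt (d j)) $ i $ j = (if i = i0 then F $ k $ j else 0)" for i
        using e(1) pos[of i0] by (auto simp: U_def sel_mat_def i0 inj_eq)
      then show ?thesis by (simp add: matrix_matrix_mult_def)
    qed
    then show ?thesis by simp
  next
    case False
    then have "d j = 0" using e(2) by auto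
    then have "F $ k $ j = 0" using o(3)[of j] by (simp add: column_def vec_eq_iff)
    moreover have "(U ** sel_mat e (\<lambda>j. sqrt (d j))) $ k $ j = 0"
      using False by (auto simp: matrix_matrix_mult_def sel_mat_def intro!: sum.neutral)
    ultimately show ?thesis by simp
  qed
  then have "F = U ** sel_mat e (\<lambda>j. sqrt (d j))" by (simp add: vec_eq_iff)
  ultimately show ?thesis using that by blast
qed

lemma gsvd_Upsilon_eq_sel_mat:
  assumes "\<And>i. pos (e i) = q + pos i"
  shows "gsvd_Upsilon q p \<nu> = sel_mat e (\<lambda>j. if pos j \<le> p then \<nu> (pos j) else 1)"
  using assms by (auto simp: gsvd_Upsilon_def sel_mat_def vec_eq_iff simp flip: pos_eq_iff)

lemma gsvd_M_eq_sel_mat: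
  assumes "\<And>i. pos (g i) = pos i"
  shows "gsvd_M q \<mu> = sel_mat g (\<lambda>j. if pos j \<le> q then 1 else \<mu> (pos j))"
  using assms by (auto simp: gsvd_M_def sel_mat_def vec_eq_iff simp flip: pos_eq_iff)

lemma rank_mult_invertible:
  fixes F :: "real^'n^'m" and T :: "real^'n^'n"
  assumes "invertible T" shows "rank (F ** T) = rank F"
proof -
  have "surj ((*v) T)"
    unfolding matrix_right_invertible_surjective[symmetric] using assms invertible_right_inverse[of T] by simp
  moreover have "range ((*v) (F ** T)) = (*v) F ` range ((*v) T)"
    by (simp only: image_image matrix_vector_mul_assoc)
  ultimately have "range ((*v) (F ** T)) = range ((*v) F)" by simp
  then show ?thesis by (simp add: rank_dim_range)
qed

text \<open>In the coordinates given by \<open>T\<close>, the Gram matrix of \<open>A\<close> is \<open>diag d\<close> and that of \<open>B\<close> is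
\<open>diag (1 - d)\<close>, so \<open>0 \<le> d \<le> 1\<close> and both \<open>A T\<close> and \<open>B T\<close> have orthogonal columns. The full row ranks say
that exactly \<open>n - m\<close> of the \<open>d j\<close> are \<open>0\<close> and exactly \<open>n - p\<close> are \<open>1\<close>. The values strictly between yield
\<open>\<nu> = sqrt d\<close> and \<open>\<mu> = sqrt (1 - d)\<close>.\<close>

lemma gsvd_exists:
  fixes A :: "real^'n::{finite,wellorder}^'m::{finite,wellorder}"
    and B :: "real^'n::_^'p::{finite,wellorder}"
  assumes rank: "rank A = CARD('m)" "rank B = CARD('p)"
    and null: "null_space B \<inter> null_space A = {0}"
    and mn: "CARD('m) \<le> CARD('n)" and pn: "CARD('p) \<le> CARD('n)"
  shows "\<exists>U V X \<nu> \<mu>. is_gsvd A B U V X \<nu> \<mu>"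
proof -
  define p q where "p = CARD('p)" and "q = CARD('n) - CARD('m)"
  define N where "N = transpose A ** A + transpose B ** B"
  have quadN: "x \<bullet> (N *v x) = (norm (A *v x))\<^sup>2 + (norm (B *v x))\<^sup>2" for x
    by (simp add: N_def matrix_vector_mult_add_rdistrib inner_add_right power2_norm_eq_inner inner_transpose_mult)
  have "sym_pos_def N"
    unfolding sym_pos_def_def
  proof (intro conjI allI impI)
    show "transpose N = N"
      by (simp add: N_def transpose_def matrix_matrix_mult_def vec_eq_iff mult.commute)
    show "0 < x \<bullet> (N *v x)" if "x \<noteq> 0" for x
    proof -
      have "A *v x \<noteq> 0 \<or> B *v x \<noteq> 0" using null that by (auto simp: null_space_def)
      then have "0 < norm (A *v x) \<or> 0 < norm (B *v x)" by simp
      then show ?thesis unfolding quadN by (meson add_nonneg_pos add_pos_nonneg zero_le_power2 zero_less_power)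
    qed
  qed
  then obtain S :: "real^'n::_^'n::_" where S: "invertible S" "transpose S ** N ** S = mat 1"
    by (rule sym_pos_def_whitening)
  define H where "H = transpose (A ** S) ** (A ** S)"
  have "transpose H = H" by (simp add: H_def matrix_transpose_mul)
  then obtain P d where P: "orthogonal_matrix P" "H = P ** diag_mat d ** transpose P"
    and sorted: "\<And>i j. i \<le> j \<Longrightarrow> d i \<le> d j"
    using symmetric_spectral_decomposition[of H] by blast
  define T where "T = S ** P"
  have "invertible P" using P(1) unfolding orthogonal_matrix_def invertible_def by blast
  then have T: "invertible T" using S(1) by (simp add: T_def invertible_mult)
  have AT: "transpose (A ** T) ** (A ** T) = diag_mat d"
  proof -
    have "transpose (A ** T) ** (A ** T) = transpose P ** H ** P"
      by (simp add: T_def H_def matrix_transpose_mul matrix_mul_assoc)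
    then show ?thesis by (simp add: P(2) matrix_mul_assoc[symmetric] orthogonal_matrix_cancel[OF P(1)]
      P(1)[unfolded orthogonal_matrix_def])
  qed
  have sum1: "transpose (A ** T) ** (A ** T) + transpose (B ** T) ** (B ** T) = mat 1"
  proof -
    have "transpose (A ** T) ** (A ** T) + transpose (B ** T) ** (B ** T) =
        transpose P ** (transpose S ** N ** S) ** P"
      by (simp add: T_def N_def matrix_transpose_mul matrix_mul_assoc matrix_add_ldistrib matrix_mult_add_rdistrib)
    then show ?thesis using P(1) by (simp add: S(2) orthogonal_matrix_def)
  qed
  have BT: "transpose (B ** T) ** (B ** T) = diag_mat (\<lambda>j. 1 - d j)"
  proof -
    have "transpose (B ** T) ** (B ** T) = mat 1 - diag_mat d"
      using sum1 unfolding AT by (metis add_diff_cancel_left')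
    also have "\<dots> = diag_mat (\<lambda>j. 1 - d j)" by (simp add: diag_mat_def mat_def vec_eq_iff)
    finally show ?thesis .
  qed
  have d01: "0 \<le> d j" "d j \<le> 1" for j
    using orthogonal_columns_nonneg(2)[OF AT, of j] orthogonal_columns_nonneg(2)[OF BT, of j] by simp_all
  have cardA: "card {j. d j \<noteq> 0} = CARD('m)"
    using rank_orthogonal_columns[OF AT] rank(1) by (simp add: rank_mult_invertible[OF T])
  have cardB: "card {j. d j \<noteq> 1} = p"
  proof -
    have "{j. 1 - d j \<noteq> 0} = {j. d j \<noteq> 1}" by auto
    then show ?thesis using rank_orthogonal_columns[OF BT] rank(2) by (simp add: p_def rank_mult_invertible[OF T])
  qed
  have "card {j. d j = 0} = q"
  proof -
    have "{j. d j = 0} = UNIV - {j. d j \<noteq> 0}" by auto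
    then show ?thesis by (simp only: card_Diff_subset[OF finite subset_UNIV] cardA q_def)
  qed
  moreover have "{j. d j = 0} = {j. pos j \<le> card {j. d j = 0}}"
  proof (rule downward_closed_eq_pos)
    show "i \<in> {j. d j = 0}" if "i \<le> j" "j \<in> {j. d j = 0}" for i j
      using sorted[OF that(1)] d01(1)[of i] that(2) by simp
  qed
  ultimately have d0: "d j = 0 \<longleftrightarrow> pos j \<le> q" for j by blast
  have "{j. d j \<noteq> 1} = {j. pos j \<le> card {j. d j \<noteq> 1}}"
  proof (rule downward_closed_eq_pos)
    show "i \<in> {j. d j \<noteq> 1}" if "i \<le> j" "j \<in> {j. d j \<noteq> 1}" for i j
      using sorted[OF that(1)] d01(2)[of j] that(2) by auto
  qed
  then have d1: "d j = 1 \<longleftrightarrow> p < pos j" for j unfolding cardB by (auto simp flip: not_le)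
  obtain e :: "'m \<Rightarrow> 'n" where e: "\<And>i. pos (e i) = q + pos i"
    using pos_shift_ex[of q, where 'm='m and 'n='n] mn by (auto simp: q_def)
  obtain g :: "'p \<Rightarrow> 'n" where g: "\<And>i. pos (g i) = 0 + pos i"
    using pos_shift_ex[of 0, where 'm='p and 'n='n] pn by auto
  have ranges: "range e = {j. d j \<noteq> 0}" "range g = {j. 1 - d j \<noteq> 0}"
    using pos_shift_range(2)[of e q, OF e] pos_shift_range(2)[of g 0, OF g] d0 d1 mn pos_bounds
    by (auto simp: q_def p_def Suc_le_eq not_le)
  obtain U where U: "orthogonal_matrix U" "A ** T = U ** sel_mat e (\<lambda>j. sqrt (d j))"
    using orthogonal_columns_factorization[OF AT pos_shift_range(1)[OF e] ranges(1)] by blast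
  obtain V where V: "orthogonal_matrix V" "B ** T = V ** sel_mat g (\<lambda>j. sqrt (1 - d j))"
    using orthogonal_columns_factorization[OF BT pos_shift_range(1)[OF g] ranges(2)] by blast
  define \<nu> where "\<nu> k = sqrt (d (inv pos k))" for k
  define \<mu> where "\<mu> k = sqrt (1 - d (inv pos k))" for k
  have inv_pos: "inv pos (pos j) = j" for j :: 'n
    by (rule inv_f_f) (simp add: inj_def pos_eq_iff)
  have "(\<lambda>j. if pos j \<le> p then \<nu> (pos j) else 1) = (\<lambda>j. sqrt (d j))"
    using d1 by (auto simp: \<nu>_def inv_pos not_le fun_eq_iff)
  then have ups: "gsvd_Upsilon q p \<nu> = sel_mat e (\<lambda>j. sqrt (d j))"
    using gsvd_Upsilon_eq_sel_mat[OF e] by metis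
  have "(\<lambda>j. if pos j \<le> q then 1 else \<mu> (pos j)) = (\<lambda>j. sqrt (1 - d j))"
    using d0 by (auto simp: \<mu>_def inv_pos fun_eq_iff)
  then have em: "gsvd_M q \<mu> = sel_mat g (\<lambda>j. sqrt (1 - d j))"
    using gsvd_M_eq_sel_mat[of g] g by simp
  define X where "X = transpose (matrix_inv T)"
  have X: "invertible X" unfolding X_def
    using matrix_inv_cancel[OF T] unfolding invertible_def by (metis matrix_transpose_mul transpose_mat)
  have "A = (A ** T) ** transpose X" "B = (B ** T) ** transpose X"
    by (simp_all add: X_def matrix_mul_assoc[symmetric] matrix_inv_cancel[OF T])
  note AB = this[unfolded U(2) V(2)]
  have at: "\<exists>j::'n. pos j = k" if "k \<in> {q+1..p}" for k
  proof -
    have "1 \<le> k" "k \<le> CARD('n)" using that pn by (auto simp: p_def)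
    then obtain j :: 'n where "pos j = k" by (rule pos_surj)
    then show ?thesis ..
  qed
  have "0 < \<nu> k \<and> \<nu> k < 1 \<and> 0 < \<mu> k \<and> \<mu> k < 1 \<and> (\<nu> k)\<^sup>2 + (\<mu> k)\<^sup>2 = 1" if k: "k \<in> {q+1..p}" for k
  proof -
    obtain j :: 'n where j: "pos j = k" using at[OF k] by auto
    then have "d j \<noteq> 0" "d j \<noteq> 1" using d0[of j] d1[of j] k by auto
    then have "0 < d j" "d j < 1" using d01[of j] by linarith+
    then show ?thesis using inv_pos[of j] by (simp add: \<nu>_def \<mu>_def j)
  qed
  moreover have "\<nu> k \<le> \<nu> l \<and> \<mu> l \<le> \<mu> k" if kl: "k \<in> {q+1..p}" "l \<in> {q+1..p}" "k \<le> l" for k l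
  proof -
    obtain i j :: 'n where ij: "pos i = k" "pos j = l" using at[OF kl(1)] at[OF kl(2)] by blast
    then have "i \<le> j" using kl(3) pos_less_iff[of j i] by (simp add: not_less[symmetric])
    then have "d i \<le> d j" by (rule sorted)
    then show ?thesis using inv_pos[of j] inv_pos[of i] by (simp add: \<nu>_def \<mu>_def ij)
  qed
  ultimately have "is_gsvd A B U V X \<nu> \<mu>"
    unfolding is_gsvd_def Let_def q_def[symmetric] p_def[symmetric] ups em
    using U(1) V(1) X AB by blast
  then show ?thesis by blast
qed

section \<open>Linear images of normal vectors\<close>

lemma borel_measurable_matrix_vector_mult [measurable]:
  fixes A :: "real^'n^'m"
  shows "(\<lambda>x. A *v x) \<in> borel_measurable borel"
  by (intro borel_measurable_continuous_onI linear_continuous_on linear_linear[THEN iffD2]) simp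

lemma borel_measurable_vec_nth [measurable (raw)]:
  fixes f :: "'a \<Rightarrow> real^'n"
  assumes [measurable]: "f \<in> borel_measurable M"
  shows "(\<lambda>x. f x $ i) \<in> borel_measurable M"
proof -
  have "(\<lambda>x. f x \<bullet> axis i 1) \<in> borel_measurable M" by measurable
  then show ?thesis by (simp add: inner_axis)
qed

text \<open>The change of variables for Lebesgue measure under an invertible matrix, in the form in which it can
be substituted into nonnegative integrals.\<close>

lemma lborel_eq_density_distr_matrix:
  fixes A :: "real^'n::{finite,wellorder}^'n::_"
  assumes "invertible A"
  shows "lborel = density (distr lborel borel ((*v) A)) (\<lambda>_. ennreal \<bar>det A\<bar>)"
proof (rule lborel_eqI)
  fix l u :: "real^'n::_"
  assume le: "\<And>b. b \<in> Basis \<Longrightarrow> l \<bullet> b \<le> u \<bullet> b"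
  let ?B = "matrix_inv A"
  note inv = matrix_inv_cancel[OF assms]
  have pre: "(*v) A -` box l u = (*v) ?B ` box l u"
  proof (intro set_eqI iffI)
    fix x assume "x \<in> (*v) A -` box l u"
    then have "A *v x \<in> box l u" by simp
    moreover have "x = ?B *v (A *v x)" by (simp add: matrix_vector_mul_assoc inv)
    ultimately show "x \<in> (*v) ?B ` box l u" by (rule rev_image_eqI)
  qed (auto simp: matrix_vector_mul_assoc inv)
  have lin: "linear ((*v) ?B)" by simp
  have img: "(*v) ?B ` box l u \<in> lmeasurable"
    "measure lebesgue ((*v) ?B ` box l u) = \<bar>det ?B\<bar> * measure lebesgue (box l u)"
    using measurable_linear_image[OF lin, of "box l u"] measure_linear_image[OF lin, of "box l u"] by simp_all
  have meas: "(*v) ?B ` box l u \<in> sets borel"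
    unfolding pre[symmetric] by (intro measurable_sets_borel[OF borel_measurable_matrix_vector_mult]) simp
  have "emeasure lborel ((*v) ?B ` box l u) = emeasure lebesgue ((*v) ?B ` box l u)"
    using meas by simp
  also have "\<dots> = ennreal (\<bar>det ?B\<bar> * measure lebesgue (box l u))"
    using emeasure_eq_measure2[OF img(1)] img(2) by simp
  finally have em: "emeasure lborel ((*v) ?B ` box l u) = ennreal (\<bar>det ?B\<bar> * measure lebesgue (box l u))" .
  have det: "det A * det ?B = 1" using inv(1) by (metis det_mul det_I)
  have "emeasure (density (distr lborel borel ((*v) A)) (\<lambda>_. ennreal \<bar>det A\<bar>)) (box l u) =
      ennreal \<bar>det A\<bar> * emeasure lborel ((*v) ?B ` box l u)"
    by (simp add: emeasure_density nn_integral_cmult emeasure_distr pre)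
  also have "\<dots> = ennreal (\<bar>det A * det ?B\<bar> * measure lebesgue (box l u))"
    unfolding em by (simp add: ennreal_mult[symmetric] abs_mult mult.assoc)
  also have "\<dots> = ennreal (\<Prod>b\<in>Basis. (u - l) \<bullet> b)"
    using le by (simp add: det measure_lborel_box_eq)
  finally show "emeasure (density (distr lborel borel ((*v) A)) (\<lambda>_. ennreal \<bar>det A\<bar>)) (box l u) =
      (\<Prod>b\<in>Basis. (u - l) \<bullet> b)" .
qed simp

lemma nn_integral_lborel_affine:
  fixes B :: "real^'n::{finite,wellorder}^'n::_"
  assumes f[measurable]: "f \<in> borel_measurable borel" and B: "invertible B"
  shows "(\<integral>\<^sup>+x. f x \<partial>lborel) = ennreal \<bar>det B\<bar> * (\<integral>\<^sup>+z. f (\<mu> + B *v z) \<partial>lborel)"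
proof -
  have "(\<integral>\<^sup>+x. f x \<partial>lborel) = (\<integral>\<^sup>+x. f (\<mu> + x) \<partial>lborel)"
    by (subst lborel_distr_plus[of \<mu>, symmetric], subst nn_integral_distr) simp_all
  also have "\<dots> = ennreal \<bar>det B\<bar> * (\<integral>\<^sup>+z. f (\<mu> + B *v z) \<partial>lborel)"
    by (subst lborel_eq_density_distr_matrix[OF B], subst nn_integral_density)
      (simp_all add: nn_integral_cmult nn_integral_distr)
  finally show ?thesis .
qed

lemma matrix_inv_mat_1: "matrix_inv (mat 1 :: real^'n^'n) = mat 1"
  by (rule matrix_inv_eqI) simp

lemma mvn_density_std: "mvn_density 0 (mat 1) z = exp (- (z \<bullet> z) / 2) / sqrt ((2 * pi) ^ CARD('n))"
  for z :: "real^'n"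
  by (simp add: mvn_density_def matrix_inv_mat_1)

lemma borel_measurable_mvn_density [measurable]:
  fixes C :: "real^'n^'n"
  shows "mvn_density \<mu> C \<in> borel_measurable borel"
proof -
  have "(\<lambda>x. exp (- ((x - \<mu>) \<bullet> (matrix_inv C *v (x - \<mu>))) / 2) / sqrt ((2 * pi) ^ CARD('n) * det C))
      \<in> borel_measurable borel" by measurable
  then show ?thesis unfolding mvn_density_def[abs_def] .
qed

text \<open>The hypotheses give \<open>C = B B\<^sup>T\<close>, so the quadratic form becomes \<open>z \<bullet> z\<close> and the Jacobian \<open>\<bar>det B\<bar>\<close> cancels
the factor \<open>sqrt (det C)\<close> of the density.\<close>

lemma mvn_density_whitened:
  fixes C W B :: "real^'n^'n"
  assumes W: "W ** C ** transpose W = mat 1" and B: "W ** B = mat 1"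
  shows "\<bar>det B\<bar> * mvn_density \<mu> C (\<mu> + B *v z) = mvn_density 0 (mat 1) z"
proof -
  have BW: "B ** W = mat 1" using B matrix_left_right_inverse by blast
  have BWt: "transpose W ** transpose B = mat 1" by (metis BW matrix_transpose_mul transpose_mat)
  have "C = B ** (W ** C ** transpose W) ** transpose B"
  proof -
    have "B ** (W ** C ** transpose W) ** transpose B = (B ** W) ** C ** (transpose W ** transpose B)"
      by (simp only: matrix_mul_assoc)
    then show ?thesis by (simp add: BW BWt)
  qed
  then have C: "C = B ** transpose B" by (simp add: W)
  have "C ** (transpose W ** W) = B ** (transpose B ** transpose W) ** W"
    unfolding C by (simp only: matrix_mul_assoc)
  also have "transpose B ** transpose W = mat 1" by (metis B matrix_transpose_mul transpose_mat)
  finally have inv: "matrix_inv C = transpose W ** W"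
    by (intro matrix_inv_eqI) (simp add: BW)
  have "(B *v z) \<bullet> (matrix_inv C *v (B *v z)) = (W *v (B *v z)) \<bullet> (W *v (B *v z))"
    unfolding inv by (simp only: inner_transpose_mult)
  also have "\<dots> = z \<bullet> z" by (simp add: matrix_vector_mul_assoc B)
  finally have quad: "(B *v z) \<bullet> (matrix_inv C *v (B *v z)) = z \<bullet> z" .
  have "det B \<noteq> 0" using B by (metis det_I det_mul mult_zero_right zero_neq_one)
  moreover have "sqrt ((2 * pi) ^ CARD('n) * det C) = sqrt ((2 * pi) ^ CARD('n)) * \<bar>det B\<bar>"
    by (simp add: C det_mul real_sqrt_mult)
  ultimately show ?thesis unfolding mvn_density_std by (simp add: mvn_density_def quad)
qed

text \<open>Substitute \<open>y = \<mu> + W\<^sup>-\<^sup>1 z\<close>. For \<open>\<mu> = 0\<close>, \<open>C = I\<close> and orthogonal \<open>W\<close> this is the rotation invariance of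
the standard normal law.\<close>

lemma mv_normal_whitening:
  fixes C W :: "real^'n::{finite,wellorder}^'n::_"
  assumes Y: "mv_normal M Y \<mu> C" and W: "W ** C ** transpose W = mat 1"
  shows "mv_normal M (\<lambda>\<omega>. W *v (Y \<omega> - \<mu>)) 0 (mat 1)"
proof -
  have Ym[measurable]: "Y \<in> borel_measurable M" and dY: "distr M borel Y = density lborel (\<lambda>x. ennreal (mvn_density \<mu> C x))"
    using Y by (auto simp: mv_normal_def distributed_def cong: distr_cong)
  have "W ** (C ** transpose W) = mat 1" using W by (simp add: matrix_mul_assoc)
  then have "invertible W" using invertible_right_inverse by blast
  define B where "B = matrix_inv W"
  note inv = matrix_inv_cancel[OF \<open>invertible W\<close>, folded B_def]
  have "invertible B" using inv unfolding invertible_def by blast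
  have "distr M borel (\<lambda>\<omega>. W *v (Y \<omega> - \<mu>)) = density lborel (\<lambda>x. ennreal (mvn_density 0 (mat 1) x))"
  proof (rule measure_eqI)
    fix A assume "A \<in> sets (distr M borel (\<lambda>\<omega>. W *v (Y \<omega> - \<mu>)))"
    then have A[measurable]: "A \<in> sets borel" by simp
    have "emeasure (distr M borel (\<lambda>\<omega>. W *v (Y \<omega> - \<mu>))) A =
        emeasure (distr (distr M borel Y) borel (\<lambda>y. W *v (y - \<mu>))) A"
      by (simp add: distr_distr comp_def)
    also have "\<dots> = (\<integral>\<^sup>+y. ennreal (mvn_density \<mu> C y) * indicator A (W *v (y - \<mu>)) \<partial>lborel)"
    proof -
      have [measurable]: "(\<lambda>y. W *v (y - \<mu>)) -` A \<in> sets borel"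
        by (rule measurable_sets_borel[OF _ A]) measurable
      show ?thesis unfolding dY
        by (simp add: emeasure_distr emeasure_density) (intro nn_integral_cong, simp split: split_indicator)
    qed
    also have "\<dots> = ennreal \<bar>det B\<bar> *
        (\<integral>\<^sup>+z. ennreal (mvn_density \<mu> C (\<mu> + B *v z)) * indicator A (W *v (\<mu> + B *v z - \<mu>)) \<partial>lborel)"
      by (rule nn_integral_lborel_affine[OF _ \<open>invertible B\<close>]) measurable
    also have "\<dots> = (\<integral>\<^sup>+z. ennreal \<bar>det B\<bar> * (ennreal (mvn_density \<mu> C (\<mu> + B *v z)) * indicator A z) \<partial>lborel)"
      by (subst nn_integral_cmult) (simp_all add: matrix_vector_mul_assoc inv)
    also have "\<dots> = (\<integral>\<^sup>+z. ennreal (mvn_density 0 (mat 1) z) * indicator A z \<partial>lborel)"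
      by (intro nn_integral_cong)
        (simp only: mult.assoc[symmetric] ennreal_mult'[OF abs_ge_zero, symmetric]
          mvn_density_whitened[OF W inv(1)])
    also have "\<dots> = emeasure (density lborel (\<lambda>x. ennreal (mvn_density 0 (mat 1) x))) A"
      by (simp add: emeasure_density)
    finally show "emeasure (distr M borel (\<lambda>\<omega>. W *v (Y \<omega> - \<mu>))) A = \<dots>" .
  qed simp
  then show ?thesis by (simp add: mv_normal_def distributed_def cong: distr_cong)
qed

section \<open>Standard normal vectors and independent coordinates\<close>

abbreviation normal_law :: "real \<Rightarrow> real measure" where
  "normal_law a \<equiv> density lborel (\<lambda>x. ennreal (normal_density a 1 x))"

lemma prob_space_normal_law: "prob_space (normal_law a)"
  by (rule prob_space_normal_density) simp

lemma emeasure_normal_law_UNIV [simp]: "emeasure (normal_law a) UNIV = 1"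
  using prob_space.emeasure_space_1[OF prob_space_normal_law, of a] by simp

lemma emeasure_normal_law_shift:
  assumes [measurable]: "A \<in> sets borel"
  shows "emeasure (normal_law 0) {x. a + x \<in> A} = emeasure (normal_law a) A"
proof -
  have [measurable]: "{x. a + x \<in> A} \<in> sets borel"
    using measurable_sets[of "\<lambda>x. a + x" borel borel A] by (simp add: vimage_def)
  have "emeasure (normal_law a) A = (\<integral>\<^sup>+x. ennreal (normal_density a 1 x) * indicator A x \<partial>lborel)"
    by (simp add: emeasure_density)
  also have "\<dots> = (\<integral>\<^sup>+x. ennreal (normal_density a 1 (a + x)) * indicator A (a + x) \<partial>lborel)"
    using nn_integral_real_affine[of "\<lambda>x. ennreal (normal_density a 1 x) * indicator A x" 1 a] by simp
  also have "\<dots> = emeasure (normal_law 0) {x. a + x \<in> A}"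
    by (simp add: emeasure_density) (intro nn_integral_cong, simp add: normal_density_def split: split_indicator)
  finally show ?thesis by simp
qed

text \<open>Joint laws of independent unit-variance normals are handled through the measures of boxes, which
determine a finite product measure.\<close>

lemma distr_PiM_normal_lawI:
  assumes I: "finite I" and X: "\<And>i. i \<in> I \<Longrightarrow> X i \<in> borel_measurable M"
    and box: "\<And>A. (\<And>i. A i \<in> sets borel) \<Longrightarrow>
      emeasure M {\<omega> \<in> space M. \<forall>i\<in>I. X i \<omega> \<in> A i} = (\<Prod>i\<in>I. emeasure (normal_law (a i)) (A i))"
  shows "distr M (Pi\<^sub>M I (\<lambda>_. borel)) (\<lambda>\<omega>. \<lambda>i\<in>I. X i \<omega>) = Pi\<^sub>M I (\<lambda>i. normal_law (a i))"
proof -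
  interpret product_prob_space "\<lambda>i. normal_law (a i)"
    by (intro product_prob_spaceI prob_space_normal_law)
  have meas: "(\<lambda>\<omega>. \<lambda>i\<in>I. X i \<omega>) \<in> M \<rightarrow>\<^sub>M Pi\<^sub>M I (\<lambda>_. borel)"
    using X by (rule measurable_restrict)
  show ?thesis
  proof (rule PiM_eqI[OF I])
    show "sets (distr M (Pi\<^sub>M I (\<lambda>_. borel)) (\<lambda>\<omega>. \<lambda>i\<in>I. X i \<omega>)) = sets (Pi\<^sub>M I (\<lambda>i. normal_law (a i)))"
      by (simp cong: sets_PiM_cong)
    fix A assume A: "\<And>i. i \<in> I \<Longrightarrow> A i \<in> sets (normal_law (a i))"
    define A' where "A' i = (if i \<in> I then A i else UNIV)" for i
    have A': "A' i \<in> sets borel" for i using A by (simp add: A'_def)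
    have "Pi\<^sub>E I A \<in> sets (Pi\<^sub>M I (\<lambda>_. borel))"
      using A I by (intro sets_PiM_I_finite) simp_all
    then have "emeasure (distr M (Pi\<^sub>M I (\<lambda>_. borel)) (\<lambda>\<omega>. \<lambda>i\<in>I. X i \<omega>)) (Pi\<^sub>E I A) =
        emeasure M ((\<lambda>\<omega>. \<lambda>i\<in>I. X i \<omega>) -` Pi\<^sub>E I A \<inter> space M)"
      by (rule emeasure_distr[OF meas])
    also have "(\<lambda>\<omega>. \<lambda>i\<in>I. X i \<omega>) -` Pi\<^sub>E I A \<inter> space M = {\<omega> \<in> space M. \<forall>i\<in>I. X i \<omega> \<in> A' i}"
      by (auto simp: A'_def PiE_iff)
    also have "emeasure M \<dots> = (\<Prod>i\<in>I. emeasure (normal_law (a i)) (A i))"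
      by (subst box[OF A']) (simp add: A'_def cong: prod.cong)
    finally show "emeasure (distr M (Pi\<^sub>M I (\<lambda>_. borel)) (\<lambda>\<omega>. \<lambda>i\<in>I. X i \<omega>)) (Pi\<^sub>E I A) =
        (\<Prod>i\<in>I. emeasure (normal_law (a i)) (A i))" .
  qed
qed

lemma mvn_density_std_prod:
  fixes x :: "real^'n"
  shows "mvn_density 0 (mat 1) x = (\<Prod>i\<in>UNIV. normal_density 0 1 (x $ i))"
proof -
  have "(\<Prod>i\<in>UNIV. normal_density 0 1 (x $ i)) =
      (1 / sqrt (2 * pi)) ^ CARD('n) * exp (\<Sum>i\<in>UNIV. - (x $ i)\<^sup>2 / 2)"
    by (simp add: normal_density_def prod.distrib exp_sum prod_dividef power_one_over)
  also have "(\<Sum>i\<in>UNIV. - (x $ i)\<^sup>2 / 2) = - (x \<bullet> x) / 2"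
    by (simp add: inner_vec_def sum_divide_distrib sum_negf power2_eq_square)
  also have "(1 / sqrt (2 * pi)) ^ CARD('n) = 1 / sqrt ((2 * pi) ^ CARD('n))"
    by (simp only: power_one_over real_sqrt_power)
  finally show ?thesis by (simp add: mvn_density_std)
qed

lemma emeasure_std_normal_box:
  fixes A :: "'n::finite \<Rightarrow> real set"
  assumes A[measurable]: "\<And>i. A i \<in> sets borel"
  shows "emeasure (density lborel (\<lambda>x::real^'n. ennreal (mvn_density 0 (mat 1) x))) {x. \<forall>i. x $ i \<in> A i} =
    (\<Prod>i\<in>UNIV. emeasure (normal_law 0) (A i))"
proof -
  define f where "f b t = normal_density 0 1 t * indicator (A (axis_index b)) t" for b :: "real^'n" and t :: real
  have fm: "f b \<in> borel_measurable borel" for b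
    unfolding f_def by measurable
  have box[measurable]: "{x::real^'n. \<forall>i. x $ i \<in> A i} \<in> sets borel" by measurable
  have Basis: "Basis = (\<lambda>i::'n. axis i (1::real)) ` UNIV" by (auto simp: Basis_vec_def)
  have inj: "inj (\<lambda>i::'n. axis i (1::real))" by (simp add: inj_def axis_eq_axis)
  have prod: "ennreal (mvn_density 0 (mat 1) x) * indicator {x. \<forall>i. x $ i \<in> A i} x =
      ennreal (\<Prod>b\<in>Basis. f b (x \<bullet> b))" for x :: "real^'n"
  proof -
    have "(\<Prod>b\<in>Basis. f b (x \<bullet> b)) = (\<Prod>i\<in>UNIV. normal_density 0 1 (x $ i) * indicator (A i) (x $ i))"
      unfolding Basis by (simp add: prod.reindex[OF inj] f_def inner_axis)
    also have "\<dots> = mvn_density 0 (mat 1) x * (\<Prod>i\<in>UNIV. indicator (A i) (x $ i))"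
      by (simp add: prod.distrib mvn_density_std_prod)
    also have "(\<Prod>i\<in>UNIV. indicator (A i) (x $ i)) = (indicator {x. \<forall>i. x $ i \<in> A i} x :: real)"
      by (auto simp: indicator_def)
    finally show ?thesis by (simp split: split_indicator)
  qed
  have "emeasure (density lborel (\<lambda>x::real^'n. ennreal (mvn_density 0 (mat 1) x))) {x. \<forall>i. x $ i \<in> A i} =
      (\<integral>\<^sup>+x. ennreal (\<Prod>b\<in>Basis. f b (x \<bullet> b)) \<partial>(lborel :: (real^'n) measure))"
    by (simp add: emeasure_density prod)
  also have "\<dots> = (\<integral>\<^sup>+x. (\<Prod>b\<in>Basis. ennreal (f b (x \<bullet> b))) \<partial>(lborel :: (real^'n) measure))"
    by (simp add: prod_ennreal f_def)
  also have "\<dots> = (\<Prod>b\<in>(Basis :: (real^'n) set). (\<integral>\<^sup>+t. ennreal (f b t) \<partial>lborel))"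
    by (rule nn_integral_lborel_prod) (use fm in \<open>auto simp: f_def\<close>)
  also have "\<dots> = (\<Prod>i\<in>UNIV. (\<integral>\<^sup>+t. ennreal (f (axis i 1) t) \<partial>lborel))"
    unfolding Basis by (simp add: prod.reindex[OF inj])
  also have "\<dots> = (\<Prod>i\<in>UNIV. emeasure (normal_law 0) (A i))"
    by (intro prod.cong refl)
      (simp add: f_def emeasure_density, intro nn_integral_cong, simp split: split_indicator)
  finally show ?thesis .
qed

lemma mv_normal_std_box:
  fixes Z :: "'w \<Rightarrow> real^'n"
  assumes Z: "mv_normal M Z 0 (mat 1)" and A[measurable]: "\<And>i. A i \<in> sets borel"
  shows "emeasure M {\<omega> \<in> space M. \<forall>i. Z \<omega> $ i \<in> A i} = (\<Prod>i\<in>UNIV. emeasure (normal_law 0) (A i))"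
proof -
  have [measurable]: "Z \<in> borel_measurable M"
    and d: "distr M borel Z = density lborel (\<lambda>x. ennreal (mvn_density 0 (mat 1) x))"
    using Z by (auto simp: mv_normal_def distributed_def cong: distr_cong)
  have [measurable]: "{x::real^'n. \<forall>i. x $ i \<in> A i} \<in> sets borel" by measurable
  have "emeasure M {\<omega> \<in> space M. \<forall>i. Z \<omega> $ i \<in> A i} = emeasure (distr M borel Z) {x. \<forall>i. x $ i \<in> A i}"
    by (subst emeasure_distr) (auto intro!: arg_cong[where f = "emeasure M"])
  then show ?thesis by (simp add: d emeasure_std_normal_box[OF A])
qed

text \<open>Boxes determine the joint law of the coordinates, and the vector is recovered from its coordinates; so
the law of \<open>Z\<close> is the one with the standard normal density.\<close>

lemma mv_normal_stdI:
  fixes Z :: "'w \<Rightarrow> real^'n"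
  assumes Z[measurable]: "Z \<in> borel_measurable M"
    and box: "\<And>A. (\<And>i. A i \<in> sets borel) \<Longrightarrow>
      emeasure M {\<omega> \<in> space M. \<forall>i. Z \<omega> $ i \<in> A i} = (\<Prod>i\<in>UNIV. emeasure (normal_law 0) (A i))"
  shows "mv_normal M Z 0 (mat 1)"
proof -
  let ?D = "density lborel (\<lambda>x::real^'n. ennreal (mvn_density 0 (mat 1) x))"
  let ?P = "Pi\<^sub>M UNIV (\<lambda>_::'n. borel) :: ('n \<Rightarrow> real) measure"
  have vec: "(\<lambda>f. \<chi> i. f i) \<in> borel_measurable ?P"
    unfolding borel_measurable_euclidean_space[of "\<lambda>f. \<chi> i. f i"] by (auto simp: Basis_vec_def inner_axis)
  have coord: "(\<lambda>x. \<lambda>i\<in>UNIV. x $ i) \<in> (borel :: (real^'n) measure) \<rightarrow>\<^sub>M ?P"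
    by (rule measurable_restrict) measurable
  have Zi: "(\<lambda>\<omega>. Z \<omega> $ i) \<in> borel_measurable M" for i by measurable
  have coordZ: "(\<lambda>\<omega>. \<lambda>i\<in>UNIV. Z \<omega> $ i) \<in> M \<rightarrow>\<^sub>M ?P"
    by (rule measurable_restrict) (rule Zi)
  have 1: "distr M ?P (\<lambda>\<omega>. \<lambda>i\<in>UNIV. Z \<omega> $ i) = Pi\<^sub>M UNIV (\<lambda>_. normal_law 0)"
    by (rule distr_PiM_normal_lawI) (simp_all add: box Zi)
  have 2: "distr ?D ?P (\<lambda>x. \<lambda>i\<in>UNIV. x $ i) = Pi\<^sub>M UNIV (\<lambda>_. normal_law 0)"
    by (rule distr_PiM_normal_lawI) (simp_all add: emeasure_std_normal_box)
  have "distr M borel Z = distr (distr M ?P (\<lambda>\<omega>. \<lambda>i\<in>UNIV. Z \<omega> $ i)) borel (\<lambda>f. \<chi> i. f i)"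
    by (subst distr_distr[OF vec coordZ]) (simp add: comp_def restrict_UNIV)
  also have "\<dots> = distr (distr ?D ?P (\<lambda>x. \<lambda>i\<in>UNIV. x $ i)) borel (\<lambda>f. \<chi> i. f i)"
    unfolding 1 2 ..
  also have "\<dots> = distr ?D borel (\<lambda>x. x)"
    by (subst distr_distr[OF vec]) (simp_all add: coord[unfolded restrict_UNIV] comp_def restrict_UNIV)
  also have "\<dots> = ?D" by (rule distr_id2) simp
  finally show ?thesis by (simp add: mv_normal_def distributed_def cong: distr_cong)
qed

text \<open>The family is extended to an orthogonal basis; normalizing leaves the unit vectors \<open>t k\<close> unchanged.\<close>

lemma orthonormal_family_extension:
  fixes t :: "nat \<Rightarrow> real^'k"
  assumes t: "\<And>k l. k < d \<Longrightarrow> l < d \<Longrightarrow> t k \<bullet> t l = (if k = l then 1 else 0)"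
  obtains R e where "orthogonal_matrix (R :: real^'k^'k)" "inj_on e {..<d}" "\<And>k. k < d \<Longrightarrow> row (e k) R = t k"
proof -
  let ?T = "t ` {..<d}"
  have inj: "inj_on t {..<d}"
  proof (rule inj_onI)
    fix k l assume "k \<in> {..<d}" "l \<in> {..<d}" "t k = t l"
    then show "k = l" using t[of k l] t[of l l] by (auto split: if_splits)
  qed
  have "pairwise orthogonal ?T"
    by (rule pairwise_imageI) (use t in \<open>auto simp: orthogonal_def\<close>)
  then obtain U where U: "U \<inter> insert 0 ?T = {}" "pairwise orthogonal (?T \<union> U)" "span (?T \<union> U) = span (?T \<union> UNIV)"
    by (rule orthogonal_extension_strong)
  define E where "E = ?T \<union> U"
  have "t k \<noteq> 0" if "k < d" for k using t[OF that that] by auto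
  then have nz: "0 \<notin> E" using U(1) by (auto simp: E_def)
  have ind: "independent E" using U(2) nz unfolding E_def by (rule pairwise_orthogonal_independent)
  have "card E = dim E" using ind by (rule dim_eq_card_independent[symmetric])
  also have "\<dots> = dim (span E)" by (rule dim_span[symmetric])
  also have "\<dots> = CARD('k)" by (simp add: E_def U(3))
  finally have "card E = CARD('k)" .
  moreover have finE: "finite E" using ind by (rule independent_imp_finite)
  ultimately obtain f :: "'k \<Rightarrow> real^'k" where f: "bij_betw f UNIV E"
    using finite_same_card_bij[of "UNIV :: 'k set" E] by auto
  have f_inj: "f i = f j \<longleftrightarrow> i = j" for i j using f by (auto simp: bij_betw_def inj_def)
  have fE: "f i \<in> E" for i using f by (auto simp: bij_betw_def)
  define R :: "real^'k^'k" where "R = (\<chi> i. f i /\<^sub>R norm (f i))"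
  have row: "row i R = f i /\<^sub>R norm (f i)" for i by (simp add: R_def row_def vec_eq_iff)
  have "orthogonal_matrix R"
    unfolding orthogonal_matrix_orthonormal_rows row
  proof (intro conjI allI impI)
    show "norm (f i /\<^sub>R norm (f i)) = 1" for i
    proof -
      have "f i \<noteq> 0" using fE[of i] nz by metis
      then show ?thesis by simp
    qed
    show "orthogonal (f i /\<^sub>R norm (f i)) (f j /\<^sub>R norm (f j))" if "i \<noteq> j" for i j
      using pairwiseD[OF U(2)[folded E_def] fE fE, of i j] f_inj[of i j] that by (simp add: orthogonal_def)
  qed
  moreover define e where "e k = inv_into UNIV f (t k)" for k
  have fe: "f (e k) = t k" if "k < d" for k
    using that f by (auto simp: e_def bij_betw_def E_def intro!: f_inv_into_f)
  have "inj_on e {..<d}"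
  proof (rule inj_onI)
    fix k l assume kl: "k \<in> {..<d}" "l \<in> {..<d}" "e k = e l"
    then have "t k = t l" using fe[of k] fe[of l] by simp
    then show "k = l" using inj kl by (auto dest: inj_onD)
  qed
  moreover have "row (e k) R = t k" if "k < d" for k
  proof -
    have "norm (t k) = 1" using t[OF that that] by (simp add: norm_eq_1)
    then show ?thesis by (simp add: row fe[OF that])
  qed
  ultimately show ?thesis using that by blast
qed

text \<open>Rotating \<open>Z\<close> by an orthogonal matrix that has the \<open>t k\<close> among its rows turns the inner products into
coordinates of another standard normal vector.\<close>

lemma orthonormal_components_law:
  fixes Z :: "'w \<Rightarrow> real^'k::{finite,wellorder}" and t :: "nat \<Rightarrow> real^'k::_"
  assumes "prob_space M" and Z: "mv_normal M Z 0 (mat 1)"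
    and t: "\<And>k l. k < d \<Longrightarrow> l < d \<Longrightarrow> t k \<bullet> t l = (if k = l then 1 else 0)"
  shows "distr M (Pi\<^sub>M {..<d} (\<lambda>_. borel)) (\<lambda>\<omega>. \<lambda>k\<in>{..<d}. a k + t k \<bullet> Z \<omega>) =
    Pi\<^sub>M {..<d} (\<lambda>k. normal_law (a k))"
proof (rule distr_PiM_normal_lawI)
  have Zm[measurable]: "Z \<in> borel_measurable M"
    using Z by (auto simp: mv_normal_def distributed_def)
  show "(\<lambda>\<omega>. a k + t k \<bullet> Z \<omega>) \<in> borel_measurable M" for k by measurable
  obtain R e where R: "orthogonal_matrix R" "inj_on e {..<d}" "\<And>k. k < d \<Longrightarrow> row (e k) R = t k"
    using orthonormal_family_extension[of d t, OF t] by blast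
  have "R ** mat 1 ** transpose R = mat 1" using R(1) by (simp add: orthogonal_matrix_def)
  from mv_normal_whitening[OF Z this]
  have RZ: "mv_normal M (\<lambda>\<omega>. R *v Z \<omega>) 0 (mat 1)" by simp
  fix A :: "nat \<Rightarrow> real set"
  assume A: "\<And>k. A k \<in> sets borel"
  define B where "B k = {x. a k + x \<in> A k}" for k
  have B: "B k \<in> sets borel" for k
    using measurable_sets[of "\<lambda>x. a k + x" borel borel "A k"] A by (simp add: vimage_def B_def)
  let ?u = "the_inv_into {..<d} e"
  define B' where "B' i = (if i \<in> e ` {..<d} then B (?u i) else UNIV)" for i
  have B': "B' i \<in> sets borel" for i using B by (simp add: B'_def)
  have B'e: "B' (e k) = B k" if "k < d" for k
    using that R(2) by (simp add: B'_def the_inv_into_f_f)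
  have Rk: "(R *v Z \<omega>) $ e k = t k \<bullet> Z \<omega>" if "k < d" for k \<omega>
    using R(3)[OF that] by (simp add: matrix_mult_dot row_def)
  have "{\<omega> \<in> space M. \<forall>k\<in>{..<d}. a k + t k \<bullet> Z \<omega> \<in> A k} = {\<omega> \<in> space M. \<forall>i. (R *v Z \<omega>) $ i \<in> B' i}"
  proof (intro Collect_cong conj_cong refl)
    fix \<omega>
    have "(\<forall>i. (R *v Z \<omega>) $ i \<in> B' i) \<longleftrightarrow> (\<forall>i\<in>e ` {..<d}. (R *v Z \<omega>) $ i \<in> B' i)"
      by (auto simp: B'_def)
    also have "\<dots> \<longleftrightarrow> (\<forall>k\<in>{..<d}. t k \<bullet> Z \<omega> \<in> B k)" by (simp add: Rk B'e)
    finally show "(\<forall>k\<in>{..<d}. a k + t k \<bullet> Z \<omega> \<in> A k) \<longleftrightarrow> (\<forall>i. (R *v Z \<omega>) $ i \<in> B' i)"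
      by (simp add: B_def)
  qed
  then have "emeasure M {\<omega> \<in> space M. \<forall>k\<in>{..<d}. a k + t k \<bullet> Z \<omega> \<in> A k} =
      (\<Prod>i\<in>UNIV. emeasure (normal_law 0) (B' i))"
    using mv_normal_std_box[OF RZ B'] by simp
  also have "\<dots> = (\<Prod>i\<in>e ` {..<d}. emeasure (normal_law 0) (B' i))"
    by (rule prod.mono_neutral_right) (auto simp: B'_def)
  also have "\<dots> = (\<Prod>k\<in>{..<d}. emeasure (normal_law 0) (B k))"
    by (simp add: prod.reindex[OF R(2)] B'e)
  also have "\<dots> = (\<Prod>k\<in>{..<d}. emeasure (normal_law (a k)) (A k))"
    by (simp add: B_def emeasure_normal_law_shift[OF A])
  finally show "emeasure M {\<omega> \<in> space M. \<forall>k\<in>{..<d}. a k + t k \<bullet> Z \<omega> \<in> A k} =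
      (\<Prod>k\<in>{..<d}. emeasure (normal_law (a k)) (A k))" .
qed simp

lemma chi_squared_orthonormal_components:
  fixes Z :: "'w \<Rightarrow> real^'k::{finite,wellorder}" and t :: "nat \<Rightarrow> real^'k::_"
  assumes "prob_space M" and Z: "mv_normal M Z 0 (mat 1)"
    and t: "\<And>k l. k < d \<Longrightarrow> l < d \<Longrightarrow> t k \<bullet> t l = (if k = l then 1 else 0)"
  shows "chi_squared M (\<lambda>\<omega>. \<Sum>k<d. (a k + t k \<bullet> Z \<omega>)\<^sup>2) d (\<Sum>k<d. (a k)\<^sup>2)"
  unfolding chi_squared_def
proof (intro conjI exI)
  have Zm[measurable]: "Z \<in> borel_measurable M"
    using Z by (auto simp: mv_normal_def distributed_def)
  show "(\<lambda>\<omega>. \<Sum>k<d. (a k + t k \<bullet> Z \<omega>)\<^sup>2) \<in> borel_measurable M" by measurable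
  let ?P = "Pi\<^sub>M {..<d} (\<lambda>_. borel) :: (nat \<Rightarrow> real) measure"
  have sq: "(\<lambda>z. \<Sum>k<d. (z k)\<^sup>2) \<in> borel_measurable ?P" by measurable
  have comp: "(\<lambda>\<omega>. \<lambda>k\<in>{..<d}. a k + t k \<bullet> Z \<omega>) \<in> M \<rightarrow>\<^sub>M ?P"
    by (rule measurable_restrict) measurable
  have law: "distr M ?P (\<lambda>\<omega>. \<lambda>k\<in>{..<d}. a k + t k \<bullet> Z \<omega>) = Pi\<^sub>M {..<d} (\<lambda>k. normal_law (a k))"
    by (rule orthonormal_components_law[OF assms(1) Z t])
  have "sum_sq_normals d a = distr (distr M ?P (\<lambda>\<omega>. \<lambda>k\<in>{..<d}. a k + t k \<bullet> Z \<omega>)) borel (\<lambda>z. \<Sum>k<d. (z k)\<^sup>2)"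
    unfolding law sum_sq_normals_def ..
  also have "\<dots> = distr M borel (\<lambda>\<omega>. \<Sum>k<d. (a k + t k \<bullet> Z \<omega>)\<^sup>2)"
    by (subst distr_distr[OF sq comp]) (simp add: comp_def)
  finally show "distr M borel (\<lambda>\<omega>. \<Sum>k<d. (a k + t k \<bullet> Z \<omega>)\<^sup>2) = sum_sq_normals d a" ..
qed simp

section \<open>Stacking two independent vectors\<close>

text \<open>The two vectors are stacked along the sum of their index types. Rotating the stacked vector is a linear
change of variables over a well-ordered index type, whence the order; the left summand comes first.\<close>

instantiation sum :: (linorder, linorder) linorder
begin

definition less_eq_sum :: "'a + 'b \<Rightarrow> 'a + 'b \<Rightarrow> bool" where
  "less_eq_sum x y \<longleftrightarrow> (case x of
     Inl a \<Rightarrow> (case y of Inl b \<Rightarrow> a \<le> b | Inr b \<Rightarrow> True)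
   | Inr a \<Rightarrow> (case y of Inl b \<Rightarrow> False | Inr b \<Rightarrow> a \<le> b))"

definition less_sum :: "'a + 'b \<Rightarrow> 'a + 'b \<Rightarrow> bool" where
  "less_sum x y \<longleftrightarrow> x \<le> y \<and> \<not> y \<le> x"

instance
  by standard (auto simp: less_eq_sum_def less_sum_def split: sum.splits)

end

instance sum :: (wellorder, wellorder) wellorder
proof
  fix P :: "'a + 'b \<Rightarrow> bool" and z :: "'a + 'b"
  assume P: "\<And>x. (\<And>y. y < x \<Longrightarrow> P y) \<Longrightarrow> P x"
  have l: "P (Inl a)" for a
  proof (induct a rule: less_induct)
    case (less a)
    show ?case
      by (rule P) (use less in \<open>auto simp: less_eq_sum_def less_sum_def not_le split: sum.splits\<close>)
  qed
  have r: "P (Inr b)" for b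
  proof (induct b rule: less_induct)
    case (less b)
    show ?case
      by (rule P) (use less l in \<open>auto simp: less_eq_sum_def less_sum_def not_le split: sum.splits\<close>)
  qed
  show "P z" using l r by (cases z) auto
qed

definition stack :: "real^'m \<Rightarrow> real^'n \<Rightarrow> real^('m + 'n)" where
  "stack x y = (\<chi> i. case i of Inl a \<Rightarrow> x $ a | Inr b \<Rightarrow> y $ b)"

lemma sum_UNIV_sum_type:
  fixes f :: "'m::finite + 'n::finite \<Rightarrow> 'a::comm_monoid_add"
  shows "(\<Sum>i\<in>UNIV. f i) = (\<Sum>a\<in>UNIV. f (Inl a)) + (\<Sum>b\<in>UNIV. f (Inr b))"
  unfolding UNIV_Plus_UNIV[symmetric] by (subst sum.Plus) simp_all

lemma prod_UNIV_sum_type: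
  fixes f :: "'m::finite + 'n::finite \<Rightarrow> 'a::comm_monoid_mult"
  shows "(\<Prod>i\<in>UNIV. f i) = (\<Prod>a\<in>UNIV. f (Inl a)) * (\<Prod>b\<in>UNIV. f (Inr b))"
  unfolding UNIV_Plus_UNIV[symmetric] by (subst prod.Plus) simp_all

lemma inner_stack: "stack x y \<bullet> stack u v = x \<bullet> u + y \<bullet> v"
  by (simp add: inner_vec_def stack_def sum_UNIV_sum_type)

lemma indep_rv_emeasure:
  assumes "prob_space M" "indep_rv M X Y" "A \<in> sets borel" "B \<in> sets borel"
  shows "emeasure M {\<omega> \<in> space M. X \<omega> \<in> A \<and> Y \<omega> \<in> B} =
    emeasure M {\<omega> \<in> space M. X \<omega> \<in> A} * emeasure M {\<omega> \<in> space M. Y \<omega> \<in> B}"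
proof -
  interpret prob_space M by fact
  have "prob ((X -` A \<inter> space M) \<inter> (Y -` B \<inter> space M)) = prob (X -` A \<inter> space M) * prob (Y -` B \<inter> space M)"
    using assms(2-4) unfolding indep_rv_def by (intro indep_setD) auto
  moreover have "(X -` A \<inter> space M) \<inter> (Y -` B \<inter> space M) = {\<omega> \<in> space M. X \<omega> \<in> A \<and> Y \<omega> \<in> B}"
    "X -` A \<inter> space M = {\<omega> \<in> space M. X \<omega> \<in> A}" "Y -` B \<inter> space M = {\<omega> \<in> space M. Y \<omega> \<in> B}" by auto
  ultimately show ?thesis by (simp add: emeasure_eq_measure ennreal_mult)
qed

lemma indep_rv_compose:
  assumes "prob_space M" "indep_rv M X Y"
    and f: "f \<in> borel_measurable borel" and g: "g \<in> borel_measurable borel"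
  shows "indep_rv M (\<lambda>\<omega>. f (X \<omega>)) (\<lambda>\<omega>. g (Y \<omega>))"
proof -
  interpret prob_space M by fact
  have ind: "indep_sets (case_bool {X -` A \<inter> space M |A. A \<in> sets borel} {Y -` B \<inter> space M |B. B \<in> sets borel}) UNIV"
    using assms(2) unfolding indep_rv_def indep_set_def .
  have pull: "{(\<lambda>\<omega>. h (V \<omega>)) -` A \<inter> space M |A. A \<in> sets borel} \<subseteq> {V -` A \<inter> space M |A. A \<in> sets borel}"
    if h: "h \<in> borel_measurable borel" for h :: "'x::topological_space \<Rightarrow> 'y::topological_space" and V
  proof -
    have "(\<lambda>\<omega>. h (V \<omega>)) -` A \<inter> space M = V -` (h -` A) \<inter> space M" for A by auto
    moreover have "h -` A \<in> sets borel" if "A \<in> sets borel" for A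
      using measurable_sets_borel[OF h that] .
    ultimately show ?thesis by blast
  qed
  show ?thesis unfolding indep_rv_def indep_set_def
  proof (rule indep_sets_mono_sets[OF ind])
    fix i :: bool
    show "case_bool {(\<lambda>\<omega>. f (X \<omega>)) -` A \<inter> space M |A. A \<in> sets borel}
         {(\<lambda>\<omega>. g (Y \<omega>)) -` B \<inter> space M |B. B \<in> sets borel} i
      \<subseteq> case_bool {X -` A \<inter> space M |A. A \<in> sets borel} {Y -` B \<inter> space M |B. B \<in> sets borel} i"
      using pull[OF f, of X] pull[OF g, of Y] by (cases i) simp_all
  qed
qed

lemma mv_normal_stack:
  fixes Z1 :: "'w \<Rightarrow> real^'m" and Z2 :: "'w \<Rightarrow> real^'n"
  assumes "prob_space M" and Z1: "mv_normal M Z1 0 (mat 1)" and Z2: "mv_normal M Z2 0 (mat 1)"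
    and indep: "indep_rv M Z1 Z2"
  shows "mv_normal M (\<lambda>\<omega>. stack (Z1 \<omega>) (Z2 \<omega>)) 0 (mat 1)"
proof (rule mv_normal_stdI)
  have [measurable]: "Z1 \<in> borel_measurable M" "Z2 \<in> borel_measurable M"
    using Z1 Z2 by (auto simp: mv_normal_def distributed_def)
  have "(\<lambda>\<omega>. stack (Z1 \<omega>) (Z2 \<omega>) \<bullet> axis i 1) \<in> borel_measurable M" for i
  proof (cases i)
    case (Inl a)
    have "(\<lambda>\<omega>. Z1 \<omega> $ a) \<in> borel_measurable M" by measurable
    then show ?thesis by (simp add: Inl stack_def inner_axis)
  next
    case (Inr b)
    have "(\<lambda>\<omega>. Z2 \<omega> $ b) \<in> borel_measurable M" by measurable
    then show ?thesis by (simp add: Inr stack_def inner_axis)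
  qed
  then show "(\<lambda>\<omega>. stack (Z1 \<omega>) (Z2 \<omega>)) \<in> borel_measurable M"
    unfolding borel_measurable_euclidean_space[of "\<lambda>\<omega>. stack (Z1 \<omega>) (Z2 \<omega>)"]
    by (auto simp: Basis_vec_def)
  fix A :: "'m + 'n \<Rightarrow> real set"
  assume A[measurable]: "\<And>i. A i \<in> sets borel"
  let ?A1 = "{x :: real^'m. \<forall>a. x $ a \<in> A (Inl a)}" and ?A2 = "{y :: real^'n. \<forall>b. y $ b \<in> A (Inr b)}"
  have [measurable]: "?A1 \<in> sets borel" "?A2 \<in> sets borel" by measurable
  have "{\<omega> \<in> space M. \<forall>i. stack (Z1 \<omega>) (Z2 \<omega>) $ i \<in> A i} = {\<omega> \<in> space M. Z1 \<omega> \<in> ?A1 \<and> Z2 \<omega> \<in> ?A2}"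
    by (auto simp: stack_def split: sum.splits)
  then have "emeasure M {\<omega> \<in> space M. \<forall>i. stack (Z1 \<omega>) (Z2 \<omega>) $ i \<in> A i} =
      emeasure M {\<omega> \<in> space M. \<forall>a. Z1 \<omega> $ a \<in> A (Inl a)} * emeasure M {\<omega> \<in> space M. \<forall>b. Z2 \<omega> $ b \<in> A (Inr b)}"
    using indep_rv_emeasure[OF assms(1) indep, of ?A1 ?A2] by simp
  then show "emeasure M {\<omega> \<in> space M. \<forall>i. stack (Z1 \<omega>) (Z2 \<omega>) $ i \<in> A i} =
      (\<Prod>i\<in>UNIV. emeasure (normal_law 0) (A i))"
    by (simp add: mv_normal_std_box[OF Z1] mv_normal_std_box[OF Z2] prod_UNIV_sum_type)
qed

section \<open>The minimum of the Tikhonov functional\<close>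

lemma diag_mat_add: "diag_mat a + diag_mat b = diag_mat (\<lambda>i. a i + b i)"
  by (simp add: diag_mat_def vec_eq_iff)

text \<open>The first two identities are \<open>\<nu>\<^sub>i\<^sup>2 + \<mu>\<^sub>i\<^sup>2 = 1\<close> on the shared diagonal positions, and \<open>1 + 0 = 1\<close>
elsewhere. The third one computes the covariance of \<open>Q s\<close>: there \<open>K = X\<^sup>T C\<^sub>m X\<close>, the summand \<open>Q\<^sup>2\<close>
comes from the noise, and the premise on \<open>K\<close> expresses that \<open>L m\<close> is whitened by its weight.\<close>

lemma gsvd_gram_identities:
  fixes \<nu> \<mu> :: "nat \<Rightarrow> real"
  defines "q \<equiv> CARD('n::{finite,wellorder}) - CARD('m::{finite,wellorder})" and "p \<equiv> CARD('p::{finite,wellorder})"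
  defines "Y \<equiv> gsvd_Upsilon q p \<nu> :: real^'n::_^'m::_" and "N \<equiv> gsvd_M q \<mu> :: real^'n::_^'p::_"
    and "Q \<equiv> gsvd_Q q p \<mu> :: real^'m::_^'m::_"
  assumes mn: "CARD('m) \<le> CARD('n)" and pn: "CARD('p) \<le> CARD('n)" and np: "CARD('n) \<le> CARD('m) + CARD('p)"
    and sv: "\<forall>k\<in>{q+1..p}. (\<nu> k)\<^sup>2 + (\<mu> k)\<^sup>2 = 1"
  shows "transpose Y ** Y + transpose N ** N = mat 1"
    and "Y ** transpose Y + Q ** Q = mat 1"
    and "N ** K ** transpose N = mat 1 \<Longrightarrow>
      (Q ** Y) ** K ** transpose (Q ** Y) + Q ** Q = diag_mat (\<lambda>i. if q + pos i \<le> p then 1 else 0)"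
    and "transpose Q = Q"
proof -
  obtain e :: "'m \<Rightarrow> 'n" where e: "\<And>i. pos (e i) = q + pos i"
    using pos_shift_ex[of q, where 'm='m and 'n='n] mn by (auto simp: q_def)
  obtain g :: "'p \<Rightarrow> 'n" where g: "\<And>i. pos (g i) = 0 + pos i"
    using pos_shift_ex[of 0, where 'm='p and 'n='n] pn by auto
  have ej: "inj e" and er: "j \<in> range e \<longleftrightarrow> q < pos j" for j
    using pos_shift_range[of e q, OF e] pos_bounds(2)[of j] mn by (auto simp: q_def)
  have gj: "inj g" and gr: "j \<in> range g \<longleftrightarrow> pos j \<le> p" for j
    using pos_shift_range[of g 0, OF g] pos_bounds(1)[of j] by (auto simp: p_def)
  have qp: "q \<le> p" using np mn by (simp add: q_def p_def)
  define c where "c j = (if pos j \<le> p then \<nu> (pos j) else 1)" for j :: 'n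
  define b where "b j = (if pos j \<le> q then 1 else \<mu> (pos j))" for j :: 'n
  have Y: "Y = sel_mat e c" unfolding Y_def c_def by (rule gsvd_Upsilon_eq_sel_mat[OF e])
  have N: "N = sel_mat g b" unfolding N_def b_def using g by (intro gsvd_M_eq_sel_mat) simp
  have Q: "Q = diag_mat (\<lambda>i. if q + pos i \<le> p then \<mu> (q + pos i) else 0)"
    unfolding Q_def gsvd_Q_def diag_mat_def ..
  show Qt: "transpose Q = Q" unfolding Q by simp
  have "(if j \<in> range e then (c j)\<^sup>2 else 0) + (if j \<in> range g then (b j)\<^sup>2 else 0) = 1" for j
    using bspec[OF sv, of "pos j"] qp by (simp add: er gr c_def b_def)
  then show "transpose Y ** Y + transpose N ** N = mat 1"
    unfolding Y N transpose_sel_mat_mult[OF ej] transpose_sel_mat_mult[OF gj] diag_mat_add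
    by (simp only: diag_mat_one)
  have sv': "(\<nu> (q + pos i))\<^sup>2 + (\<mu> (q + pos i))\<^sup>2 = 1" if "q + pos i \<le> p" for i :: 'm
    using bspec[OF sv, of "q + pos i"] pos_bounds(1)[of i] that by simp
  show "Y ** transpose Y + Q ** Q = mat 1"
    unfolding Y Q sel_mat_mult_transpose[OF ej] diag_mat_mult
    using sv' by (simp add: diag_mat_def mat_def vec_eq_iff c_def e power2_eq_square)
  define R :: "real^'p::_^'m::_" where "R = (\<chi> i l. if g l = e i then \<nu> (pos (g l)) else 0)"
  \<comment> \<open>On the diagonal positions that the two factors share, \<open>\<mu> \<Upsilon>\<close> is \<open>\<nu> N\<close>; so the covariance of the
    second factor, which is known, determines that of \<open>Q \<Upsilon>\<close>.\<close>
  have QY: "Q ** Y = R ** N"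
  proof -
    have "(Q ** Y) $ i $ j = (R ** N) $ i $ j" for i j
    proof -
      have l: "(Q ** Y) $ i $ j = (if q + pos i \<le> p \<and> j = e i then \<mu> (q + pos i) * \<nu> (q + pos i) else 0)"
        unfolding Q Y by (auto simp: matrix_matrix_mult_def diag_mat_def sel_mat_def mult_delta_left c_def e)
      show ?thesis
      proof (cases "j = e i \<and> pos j \<le> p")
        case True
        then obtain l0 where l0: "j = g l0" using gr by blast
        have "R $ i $ l * N $ l $ j = (if l = l0 then \<nu> (pos j) * \<mu> (pos j) else 0)" for l
          using True pos_bounds(1)[of i] e[of i] gj
          by (auto simp: R_def N sel_mat_def l0 inj_eq b_def)
        then have "(R ** N) $ i $ j = \<nu> (pos j) * \<mu> (pos j)" by (simp add: matrix_matrix_mult_def)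
        moreover have qi: "q + pos i \<le> p" "pos j = q + pos i" using True e[of i] by auto
        have "(Q ** Y) $ i $ j = \<mu> (q + pos i) * \<nu> (q + pos i)"
          unfolding l by (rule if_P) (use True qi in blast)
        ultimately show ?thesis by (simp only: qi(2) mult.commute)
      next
        case False
        have "R $ i $ l * N $ l $ j = 0" for l
        proof -
          have "\<not> (g l = e i \<and> j = g l)" using False gr[of j] by blast
          then show ?thesis by (simp add: R_def N sel_mat_def)
        qed
        then have "(R ** N) $ i $ j = 0"
          unfolding matrix_matrix_mult_def by (simp only: vec_lambda_beta sum.neutral_const)
        then show ?thesis using l False e[of i] by auto
      qed
    qed
    then show ?thesis by (simp add: vec_eq_iff)
  qed
  have RR: "R ** transpose R = diag_mat (\<lambda>i. if q + pos i \<le> p then (\<nu> (q + pos i))\<^sup>2 else 0)"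
  proof -
    have "(\<Sum>l\<in>UNIV. R $ i $ l * R $ j $ l) =
        (if i = j then if q + pos i \<le> p then (\<nu> (q + pos i))\<^sup>2 else 0 else 0)" for i j
    proof (cases "i = j \<and> q + pos i \<le> p")
      case True
      then have ij: "i = j" and qi: "q + pos i \<le> p" by blast+
      have "pos (e i) \<le> p" unfolding e by (rule qi)
      then obtain l0 where l0: "e i = g l0" using gr by blast
      have "R $ i $ l * R $ j $ l = (if l = l0 then (\<nu> (q + pos i))\<^sup>2 else 0)" for l
        unfolding ij[symmetric] using gj e[of i]
        by (auto simp: R_def l0 inj_eq power2_eq_square)
      then have "(\<Sum>l\<in>UNIV. R $ i $ l * R $ j $ l) = (\<nu> (q + pos i))\<^sup>2" by simp
      then show ?thesis using ij qi by simp
    next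
      case False
      have "R $ i $ l * R $ j $ l = 0" for l
      proof -
        have "\<not> (g l = e i \<and> g l = e j)"
        proof
          assume *: "g l = e i \<and> g l = e j"
          then have "i = j" using ej by (metis injD)
          moreover have "pos (e i) \<le> p" using gr[of "e i"] * by (metis rangeI)
          ultimately show False using False e[of i] by simp
        qed
        then show ?thesis by (auto simp: R_def)
      qed
      then have "(\<Sum>l\<in>UNIV. R $ i $ l * R $ j $ l) = 0" by (simp only: sum.neutral_const)
      then show ?thesis using False by simp
    qed
    then show ?thesis by (simp add: matrix_matrix_mult_def transpose_def diag_mat_def vec_eq_iff)
  qed
  assume K: "N ** K ** transpose N = mat 1"
  have "(Q ** Y) ** K ** transpose (Q ** Y) = R ** (N ** K ** transpose N) ** transpose R"
    unfolding QY by (simp add: matrix_transpose_mul matrix_mul_assoc)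
  then have "(Q ** Y) ** K ** transpose (Q ** Y) = R ** transpose R" by (simp add: K)
  then show "(Q ** Y) ** K ** transpose (Q ** Y) + Q ** Q = diag_mat (\<lambda>i. if q + pos i \<le> p then 1 else 0)"
    unfolding RR Q diag_mat_mult
    using sv' by (simp add: diag_mat_def vec_eq_iff power2_eq_square)
qed

lemma norm_orthogonal_matrix_mult:
  assumes "orthogonal_matrix (U :: real^'n^'n)"
  shows "norm (U *v x) = norm x"
  using assms by (simp add: norm_eq inner_transpose_mult orthogonal_matrix)

text \<open>In the coordinates \<open>y = X\<^sup>T (x - m\<^sub>0)\<close> the functional is \<open>\<parallel>\<Upsilon> y - s\<parallel>\<^sup>2 + \<parallel>N y\<parallel>\<^sup>2\<close>, since orthogonal
matrices preserve norms. Its quadratic part is \<open>y \<bullet> y\<close> by the first Gram identity, so it equals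
\<open>\<parallel>y - \<Upsilon>\<^sup>T s\<parallel>\<^sup>2 + \<parallel>s\<parallel>\<^sup>2 - \<parallel>\<Upsilon>\<^sup>T s\<parallel>\<^sup>2\<close>; the second identity evaluates the constant.\<close>

lemma tik_functional_gsvd:
  fixes G :: "real^'n::{finite,wellorder}^'m::{finite,wellorder}"
    and L :: "real^'n::_^'p::{finite,wellorder}"
    and d :: "real^'m::_" and m0 :: "real^'n::_"
  assumes gsvd: "is_gsvd (Wd ** G) (W ** L) U V X \<nu> \<mu>"
    and mn: "CARD('m) \<le> CARD('n)" and pn: "CARD('p) \<le> CARD('n)" and np: "CARD('n) \<le> CARD('m) + CARD('p)"
  defines "q \<equiv> CARD('n) - CARD('m)" and "p \<equiv> CARD('p)"
  defines "s \<equiv> transpose U *v (Wd *v (d - G *v m0))"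
  shows "tik_functional Wd G W L d m0 x =
    (norm (transpose X *v (x - m0) - transpose (gsvd_Upsilon q p \<nu>) *v s))\<^sup>2 + (norm (gsvd_Q q p \<mu> *v s))\<^sup>2"
proof -
  define Y N Q where "Y = (gsvd_Upsilon q p \<nu> :: real^'n::_^'m::_)" and "N = (gsvd_M q \<mu> :: real^'n::_^'p::_)"
    and "Q = (gsvd_Q q p \<mu> :: real^'m::_^'m::_)"
  have U: "orthogonal_matrix U" and V: "orthogonal_matrix V"
    and A: "Wd ** G = U ** Y ** transpose X" and B: "W ** L = V ** N ** transpose X"
    and sv: "\<forall>k\<in>{q+1..p}. (\<nu> k)\<^sup>2 + (\<mu> k)\<^sup>2 = 1"
    using gsvd unfolding is_gsvd_def Let_def Y_def N_def p_def q_def by auto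
  note gram = gsvd_gram_identities[OF mn pn np, where \<nu>=\<nu> and \<mu>=\<mu>, folded p_def q_def, OF sv, folded Y_def N_def Q_def]
  define y where "y = transpose X *v (x - m0)"
  have Us: "U *v s = Wd *v (d - G *v m0)"
    using U by (simp add: s_def matrix_vector_mul_assoc orthogonal_matrix_def matrix_mul_assoc)
  have "Wd *v (G *v x - d) = (Wd ** G) *v (x - m0) - Wd *v (d - G *v m0)"
    by (simp add: matrix_vector_mul_assoc[symmetric] matrix_vector_mult_diff_distrib)
  also have "\<dots> = U *v (Y *v y - s)"
    unfolding Us[symmetric] A y_def by (simp add: matrix_vector_mul_assoc[symmetric] matrix_vector_mult_diff_distrib)
  finally have 1: "norm (Wd *v (G *v x - d)) = norm (Y *v y - s)"
    by (simp add: norm_orthogonal_matrix_mult[OF U])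
  have "(W ** L) *v (x - m0) = V *v (N *v y)"
    unfolding B y_def by (simp add: matrix_vector_mul_assoc[symmetric])
  then have 2: "norm ((W ** L) *v (x - m0)) = norm (N *v y)"
    by (simp add: norm_orthogonal_matrix_mult[OF V])
  have yy: "(Y *v y) \<bullet> (Y *v y) + (N *v y) \<bullet> (N *v y) = y \<bullet> y"
    unfolding inner_transpose_mult inner_add_right[symmetric] matrix_vector_mult_add_rdistrib[symmetric] gram(1)
    by simp
  have "(transpose Y *v s) \<bullet> (transpose Y *v s) + (Q *v s) \<bullet> (Q *v s) = s \<bullet> s"
    unfolding inner_transpose_mult inner_add_right[symmetric] matrix_vector_mult_add_rdistrib[symmetric]
    by (simp add: gram(2,4))
  moreover have "y \<bullet> (transpose Y *v s) = (Y *v y) \<bullet> s"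
    by (metis dot_lmul_matrix inner_commute transpose_matrix_vector transpose_transpose)
  ultimately have "(norm (Y *v y - s))\<^sup>2 + (norm (N *v y))\<^sup>2 =
      (norm (y - transpose Y *v s))\<^sup>2 + (norm (Q *v s))\<^sup>2"
    using yy by (simp add: power2_norm_eq_inner inner_diff_left inner_diff_right
      inner_commute[of s "Y *v y"] inner_commute[of "s v* Y" y])
  then show ?thesis
    by (simp add: tik_functional_def 1 2 y_def Y_def Q_def)
qed

lemma tik_functional_arg_min:
  fixes G :: "real^'n::{finite,wellorder}^'m::{finite,wellorder}"
    and L :: "real^'n::_^'p::{finite,wellorder}"
  assumes gsvd: "is_gsvd (Wd ** G) (W ** L) U V X \<nu> \<mu>"
    and mn: "CARD('m) \<le> CARD('n)" and pn: "CARD('p) \<le> CARD('n)" and np: "CARD('n) \<le> CARD('m) + CARD('p)"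
  shows "\<exists>!x. is_arg_min (tik_functional Wd G W L d m0) (\<lambda>_. True) x"
    and "tik_functional Wd G W L d m0 (m_tik Wd G W L d m0) =
      (norm (gsvd_Q (CARD('n) - CARD('m)) CARD('p) \<mu> *v (transpose U *v (Wd *v (d - G *v m0)))))\<^sup>2"
proof -
  define s where "s = transpose U *v (Wd *v (d - G *v m0))"
  define w where "w = transpose (gsvd_Upsilon (CARD('n) - CARD('m)) CARD('p) \<nu> :: real^'n::_^'m::_) *v s"
  define c where "c = (norm (gsvd_Q (CARD('n) - CARD('m)) CARD('p) \<mu> *v s))\<^sup>2"
  let ?f = "tik_functional Wd G W L d m0"
  have f: "?f x = (norm (transpose X *v (x - m0) - w))\<^sup>2 + c" for x
    unfolding w_def c_def s_def by (rule tik_functional_gsvd[OF gsvd mn pn np])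
  have "invertible (transpose X)"
    using gsvd by (simp add: is_gsvd_def Let_def transpose_invertible)
  note inv = matrix_inv_cancel[OF this]
  \<comment> \<open>The point at which the first square vanishes.\<close>
  define x0 where "x0 = m0 + matrix_inv (transpose X) *v w"
  have zero: "transpose X *v (x0 - m0) = w"
    by (simp add: x0_def matrix_vector_mul_assoc inv)
  have uniq: "x = x0" if "transpose X *v (x - m0) = w" for x
  proof -
    have "x - m0 = matrix_inv (transpose X) *v (transpose X *v (x - m0))"
      by (simp only: matrix_vector_mul_assoc inv matrix_vector_mul_lid)
    then show ?thesis unfolding that x0_def by (simp add: algebra_simps)
  qed
  have min: "?f x0 = c" unfolding f zero by simp
  have le: "c \<le> ?f x" for x unfolding f by simp
  have arg: "is_arg_min ?f (\<lambda>_. True) x \<longleftrightarrow> x = x0" for x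
  proof
    assume "is_arg_min ?f (\<lambda>_. True) x"
    then have "\<not> ?f x0 < ?f x" by (simp add: is_arg_min_def)
    then have "?f x \<le> c" unfolding min by simp
    then have "(norm (transpose X *v (x - m0) - w))\<^sup>2 \<le> 0" unfolding f by simp
    then have "transpose X *v (x - m0) = w" by simp
    then show "x = x0" by (rule uniq)
  next
    assume "x = x0"
    then show "is_arg_min ?f (\<lambda>_. True) x" using le by (simp add: is_arg_min_def min not_less)
  qed
  show "\<exists>!x. is_arg_min ?f (\<lambda>_. True) x" unfolding arg by simp
  have "m_tik Wd G W L d m0 = x0" unfolding m_tik_def arg by simp
  then show "?f (m_tik Wd G W L d m0) = (norm (gsvd_Q (CARD('n) - CARD('m)) CARD('p) \<mu> *v
      (transpose U *v (Wd *v (d - G *v m0)))))\<^sup>2"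
    using min by (simp add: c_def s_def)
qed

section \<open>The law of the minimum\<close>

lemma rank_invertible_mult:
  fixes F :: "real^'n^'m" and T :: "real^'m^'m"
  assumes "invertible T" shows "rank (T ** F) = rank F"
proof -
  have "rank (T ** F) = rank (transpose F ** transpose T)"
    by (metis rank_transpose matrix_transpose_mul)
  also have "\<dots> = rank (transpose F)"
    using assms by (intro rank_mult_invertible) (simp add: transpose_invertible)
  finally show ?thesis by (simp add: rank_transpose)
qed

lemma sym_pos_def_congruence:
  fixes L :: "real^'n^'p"
  assumes C: "sym_pos_def C" and L: "rank L = CARD('p)"
  shows "sym_pos_def (L ** C ** transpose L)"
  unfolding sym_pos_def_def
proof (intro conjI allI impI)
  have Ct: "transpose C = C" using C by (simp add: sym_pos_def_def)
  show "transpose (L ** C ** transpose L) = L ** C ** transpose L"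
    by (simp add: matrix_transpose_mul Ct matrix_mul_assoc)
  fix x :: "real^'p" assume "x \<noteq> 0"
  have "rank (transpose L) = CARD('p)" using L by (simp add: rank_transpose)
  then have "inj ((*v) (transpose L))" by (simp add: full_rank_injective)
  then have "transpose L *v x \<noteq> 0" using \<open>x \<noteq> 0\<close> by (metis injD matrix_vector_mult_0_right)
  then have "0 < (transpose L *v x) \<bullet> (C *v (transpose L *v x))" using C by (simp add: sym_pos_def_def)
  also have "\<dots> = x \<bullet> ((L ** C ** transpose L) *v x)"
    by (simp add: matrix_vector_mul_assoc[symmetric] dot_lmul_matrix)
  finally show "0 < x \<bullet> ((L ** C ** transpose L) *v x)" .
qed

lemma row_inner_row: "row i A \<bullet> row j B = (A ** transpose B) $ i $ j"
  for A :: "real^'n^'m" and B :: "real^'n^'k"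
  by (simp add: row_def inner_vec_def matrix_matrix_mult_def transpose_def)

lemma row_inner: "row i A \<bullet> x = (A *v x) $ i" for A :: "real^'n^'m"
  by (simp add: row_def matrix_mult_dot)

text \<open>With \<open>T1 = Q U\<^sup>T\<close> and \<open>T2 = Q U\<^sup>T W\<^sub>d G W\<^sub>m\<^sup>-\<^sup>1\<close>, the vector \<open>Q s\<close> is a constant plus \<open>T1\<close> and \<open>T2\<close>
applied to the whitened noise and the whitened model. The stacked rows of \<open>T1\<close> and \<open>T2\<close> have the Gram
matrix \<open>T1 T1\<^sup>T + T2 T2\<^sup>T\<close>, which is the identity on the rows where \<open>Q\<close> does not vanish.\<close>

lemma minimum_law:
  fixes G :: "real^'n::{finite,wellorder}^'m::{finite,wellorder}"
    and L :: "real^'n::_^'p::{finite,wellorder}"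
    and Cd Wd :: "real^'m::_^'m::_" and W :: "real^'p::_^'p::_"
    and noise :: "'w \<Rightarrow> real^'m::_" and m :: "'w \<Rightarrow> real^'n::_"
  assumes M: "prob_space M"
    and mn: "CARD('m) \<le> CARD('n)" and pn: "CARD('p) \<le> CARD('n)" and np: "CARD('n) \<le> CARD('m) + CARD('p)"
    and noise: "mv_normal M noise 0 Cd" and m: "mv_normal M m mhat Cm" and indep: "indep_rv M noise m"
    and Wd: "Wd ** Cd ** transpose Wd = mat 1" and Cm: "sym_pos_def Cm"
    and W: "(W ** L) ** Cm ** transpose (W ** L) = mat 1"
    and gsvd: "is_gsvd (Wd ** G) (W ** L) U V X \<nu> \<mu>"
  defines "Q \<equiv> gsvd_Q (CARD('n) - CARD('m)) CARD('p) \<mu>"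
  shows "chi_squared M (\<lambda>\<omega>. (norm (Q *v (transpose U *v (Wd *v (G *v m \<omega> + noise \<omega> - G *v m0)))))\<^sup>2)
    (CARD('m) + CARD('p) - CARD('n)) ((norm ((Q ** transpose U ** Wd ** G) *v (mhat - m0)))\<^sup>2)"
proof -
  define p q where "p = CARD('p)" and "q = CARD('n) - CARD('m)"
  define d where "d = CARD('m) + CARD('p) - CARD('n)"
  have d: "d = p - q" "d \<le> CARD('m)" using mn pn np by (simp_all add: d_def p_def q_def)
  define Y N where "Y = (gsvd_Upsilon q p \<nu> :: real^'n::_^'m::_)" and "N = (gsvd_M q \<mu> :: real^'n::_^'p::_)"
  have Qdef: "Q = gsvd_Q q p \<mu>" by (simp add: Q_def p_def q_def)
  have U: "orthogonal_matrix U" and V: "orthogonal_matrix V"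
    and A: "Wd ** G = U ** Y ** transpose X" and B: "W ** L = V ** N ** transpose X"
    and sv: "\<forall>k\<in>{q+1..p}. (\<nu> k)\<^sup>2 + (\<mu> k)\<^sup>2 = 1"
    using gsvd unfolding is_gsvd_def Let_def Y_def N_def p_def q_def by auto
  note gram = gsvd_gram_identities[OF mn pn np, where \<nu>=\<nu> and \<mu>=\<mu>, folded p_def q_def, OF sv,
    folded Y_def N_def Qdef]

  obtain S :: "real^'n::_^'n::_" where S: "invertible S" "transpose S ** Cm ** S = mat 1"
    using sym_pos_def_whitening[OF Cm] by blast
  define Wm Bm where "Wm = transpose S" and "Bm = matrix_inv Wm"
  have Wm: "Wm ** Cm ** transpose Wm = mat 1" using S by (simp add: Wm_def)
  have "invertible Wm" using S(1) by (simp add: Wm_def transpose_invertible)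
  note inv = matrix_inv_cancel[OF this, folded Bm_def]
  have CmB: "Bm ** transpose Bm = Cm"
  proof -
    have "transpose Wm ** transpose Bm = mat 1" by (metis inv(2) matrix_transpose_mul transpose_mat)
    moreover have "Bm ** (Wm ** Cm ** transpose Wm) ** transpose Bm = (Bm ** Wm) ** Cm ** (transpose Wm ** transpose Bm)"
      by (simp only: matrix_mul_assoc)
    ultimately show ?thesis by (simp add: Wm inv)
  qed

  define Z where "Z \<omega> = stack (Wd *v (noise \<omega> - 0)) (Wm *v (m \<omega> - mhat))" for \<omega>
  have Z: "mv_normal M Z 0 (mat 1)"
    unfolding Z_def
  proof (rule mv_normal_stack[OF M])
    show "mv_normal M (\<lambda>\<omega>. Wd *v (noise \<omega> - 0)) 0 (mat 1)" by (rule mv_normal_whitening[OF noise Wd])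
    show "mv_normal M (\<lambda>\<omega>. Wm *v (m \<omega> - mhat)) 0 (mat 1)" by (rule mv_normal_whitening[OF m Wm])
    show "indep_rv M (\<lambda>\<omega>. Wd *v (noise \<omega> - 0)) (\<lambda>\<omega>. Wm *v (m \<omega> - mhat))"
      by (rule indep_rv_compose[OF M indep]) measurable
  qed

  define T1 T2 where "T1 = Q ** transpose U" and "T2 = Q ** transpose U ** Wd ** G ** Bm"
  define c where "c = (Q ** transpose U ** Wd ** G) *v (mhat - m0)"
  \<comment> \<open>The rows on which \<open>Q\<close> does not vanish are those at the positions \<open>1, \<dots>, d\<close>.\<close>
  define \<iota> where "\<iota> k = inv (pos :: 'm \<Rightarrow> nat) (Suc k)" for k
  have pos_\<iota>: "pos (\<iota> k) = Suc k" if "k < d" for k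
  proof -
    have "1 \<le> Suc k" "Suc k \<le> CARD('m)" using that d by simp_all
    then obtain i :: 'm where "pos i = Suc k" by (rule pos_surj)
    then have "Suc k \<in> range (pos :: 'm \<Rightarrow> nat)" using rangeI[of pos i] by simp
    then show ?thesis unfolding \<iota>_def by (rule f_inv_into_f)
  qed
  have \<iota>_inj: "inj_on \<iota> {..<d}"
  proof (rule inj_onI)
    fix k l assume "k \<in> {..<d}" "l \<in> {..<d}" "\<iota> k = \<iota> l"
    then have "Suc k = Suc l" using pos_\<iota>[of k] pos_\<iota>[of l] by (metis lessThan_iff)
    then show "k = l" by simp
  qed
  have \<iota>_range: "i \<in> \<iota> ` {..<d} \<longleftrightarrow> q + pos i \<le> p" for i
  proof
    assume "q + pos i \<le> p"
    then have k: "pos i - 1 < d" "Suc (pos i - 1) = pos i" using d(1) pos_bounds(1)[of i] by simp_all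
    then have "pos (\<iota> (pos i - 1)) = pos i" using pos_\<iota>[of "pos i - 1"] by simp
    then have "i = \<iota> (pos i - 1)" by (simp add: pos_eq_iff)
    then show "i \<in> \<iota> ` {..<d}" using k(1) by blast
  next
    assume "i \<in> \<iota> ` {..<d}"
    then obtain k where "k < d" "i = \<iota> k" by blast
    then show "q + pos i \<le> p" using pos_\<iota>[of k] d(1) by simp
  qed

  have Qs: "Q *v (transpose U *v (Wd *v (G *v m \<omega> + noise \<omega> - G *v m0))) =
      c + T1 *v (Wd *v (noise \<omega> - 0)) + T2 *v (Wm *v (m \<omega> - mhat))" for \<omega>
  proof -
    have "T2 *v (Wm *v (m \<omega> - mhat)) = (Q ** transpose U ** Wd ** G ** (Bm ** Wm)) *v (m \<omega> - mhat)"
      by (simp add: T2_def matrix_vector_mul_assoc matrix_mul_assoc)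
    then have "T2 *v (Wm *v (m \<omega> - mhat)) = (Q ** transpose U ** Wd ** G) *v (m \<omega> - mhat)"
      by (simp add: inv)
    then show ?thesis
      by (simp add: T1_def c_def matrix_vector_mul_assoc[symmetric] matrix_vector_mult_diff_distrib
          matrix_vector_right_distrib)
  qed
  have Q0: "(Q *v x) $ i = 0" if "i \<notin> \<iota> ` {..<d}" for x i
    using that by (simp add: \<iota>_range Qdef gsvd_Q_def matrix_vector_mult_def)
  have norm_Q: "(norm (Q *v x))\<^sup>2 = (\<Sum>k<d. ((Q *v x) $ \<iota> k)\<^sup>2)" for x
  proof -
    have "(norm (Q *v x))\<^sup>2 = (\<Sum>i\<in>UNIV. ((Q *v x) $ i)\<^sup>2)"
      by (simp only: power2_norm_eq_inner inner_vec_def) (simp add: power2_eq_square)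
    also have "\<dots> = (\<Sum>i\<in>\<iota> ` {..<d}. ((Q *v x) $ i)\<^sup>2)"
      by (rule sum.mono_neutral_right) (auto simp: Q0)
    finally show ?thesis by (simp add: sum.reindex[OF \<iota>_inj])
  qed

  have K: "N ** (transpose X ** Cm ** X) ** transpose N = mat 1"
  proof -
    have "V ** (N ** (transpose X ** Cm ** X) ** transpose N) ** transpose V = mat 1"
      using W unfolding B by (simp add: matrix_transpose_mul matrix_mul_assoc)
    then have "transpose V ** (V ** (N ** (transpose X ** Cm ** X) ** transpose N) ** transpose V) ** V
        = transpose V ** mat 1 ** V" by simp
    then show ?thesis
      using V by (simp add: matrix_mul_assoc[symmetric] orthogonal_matrix_cancel orthogonal_matrix_def)
  qed
  have T1: "T1 ** transpose T1 = Q ** Q"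
    using U by (simp add: T1_def matrix_transpose_mul gram(4) matrix_mul_assoc[symmetric] orthogonal_matrix_cancel)
  have T2: "T2 ** transpose T2 = (Q ** Y) ** (transpose X ** Cm ** X) ** transpose (Q ** Y)"
  proof -
    have "T2 = Q ** transpose U ** (Wd ** G) ** Bm" by (simp add: T2_def matrix_mul_assoc)
    also have "\<dots> = Q ** Y ** transpose X ** Bm"
      unfolding A using U by (simp add: matrix_mul_assoc[symmetric] orthogonal_matrix_cancel)
    finally have "T2 ** transpose T2 = Q ** Y ** transpose X ** (Bm ** transpose Bm) ** X ** transpose (Q ** Y)"
      by (simp add: matrix_transpose_mul matrix_mul_assoc)
    then show ?thesis by (simp add: CmB matrix_mul_assoc)
  qed
  have cov: "T1 ** transpose T1 + T2 ** transpose T2 = diag_mat (\<lambda>i. if q + pos i \<le> p then 1 else 0)"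
    unfolding T1 T2 using gram(3)[OF K] by (simp add: add.commute)

  define t where "t k = stack (row (\<iota> k) T1) (row (\<iota> k) T2)" for k
  have t: "t k \<bullet> t l = (if k = l then 1 else 0)" if "k < d" "l < d" for k l
  proof -
    have "t k \<bullet> t l = (T1 ** transpose T1 + T2 ** transpose T2) $ \<iota> k $ \<iota> l"
      by (simp add: t_def inner_stack row_inner_row)
    moreover have "\<iota> k = \<iota> l \<longleftrightarrow> k = l" using \<iota>_inj that by (auto dest: inj_onD)
    moreover have "q + pos (\<iota> k) \<le> p" using \<iota>_range[of "\<iota> k"] that by blast
    ultimately show ?thesis unfolding cov by (cases "k = l") (simp_all add: diag_mat_def)
  qed
  have "chi_squared M (\<lambda>\<omega>. \<Sum>k<d. (c $ \<iota> k + t k \<bullet> Z \<omega>)\<^sup>2) d (\<Sum>k<d. (c $ \<iota> k)\<^sup>2)"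
    by (rule chi_squared_orthonormal_components[OF M Z t])
  moreover have "(\<Sum>k<d. (c $ \<iota> k + t k \<bullet> Z \<omega>)\<^sup>2) =
      (norm (Q *v (transpose U *v (Wd *v (G *v m \<omega> + noise \<omega> - G *v m0)))))\<^sup>2" for \<omega>
    unfolding norm_Q unfolding Qs by (simp add: t_def Z_def inner_stack row_inner add.assoc)
  moreover have "(\<Sum>k<d. (c $ \<iota> k)\<^sup>2) = (norm c)\<^sup>2"
    using norm_Q[of "transpose U *v (Wd *v (G *v (mhat - m0)))"]
    by (simp add: c_def matrix_vector_mul_assoc matrix_mul_assoc)
  ultimately show ?thesis by (simp add: c_def d_def)
qed

text \<open>The square root is symmetric, so \<open>W\<^sub>L C\<^sub>L W\<^sub>L = I\<close>, which is the covariance hypothesis of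
\<open>minimum_law\<close>. Both weights are invertible and leave the ranks of \<open>G\<close> and \<open>L\<close> unchanged, which gives
the decomposition.\<close>

theorem theorem2p1:
  fixes M :: "'w measure"
    and G :: "real^'n::{finite,wellorder}^'m::{finite,wellorder}"
    and L :: "real^'n::_^'p::{finite,wellorder}"
    and Cd Wd :: "real^'m::_^'m::_"
    and Cm :: "real^'n::_^'n::_"
    and CL WL :: "real^'p::_^'p::_"
    and mhat m0 :: "real^'n::_"
    and noise dobs :: "'w \<Rightarrow> real^'m::_"
    and m :: "'w \<Rightarrow> real^'n::_"
    and q :: nat
  assumes "prob_space M"
    and "CARD('m) < CARD('n)" and "CARD('p) \<le> CARD('n)"
    and "CARD('n) < CARD('m) + CARD('p)"
    and "rank G = CARD('m)" and "rank L = CARD('p)"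
    and "sym_pos_def Cd" and "sym_pos_def Cm"
    and "mv_normal M noise 0 Cd" and "mv_normal M m mhat Cm"
    and "indep_rv M noise m"
    and "\<And>\<omega>. dobs \<omega> = G *v m \<omega> + noise \<omega>"
    and "CL = L ** Cm ** transpose L"
    and "transpose Wd ** Wd = matrix_inv Cd"
    and "WL = matrix_sqrt (matrix_inv CL)"
    and "null_space (WL ** L) \<inter> null_space (Wd ** G) = {0}"
    and "q = CARD('n) - CARD('m)"
  shows
    "(\<forall>d. \<exists>!x. is_arg_min (tik_functional Wd G WL L d m0) (\<lambda>_. True) x) \<and>
     (\<exists>U V X \<nu> \<mu>. is_gsvd (Wd ** G) (WL ** L) U V X \<nu> \<mu>) \<and>
     (\<forall>U V X \<nu> \<mu>. is_gsvd (Wd ** G) (WL ** L) U V X \<nu> \<mu> \<longrightarrow>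
        (m0 = mhat \<longrightarrow>
           chi_squared M
             (\<lambda>\<omega>. tik_functional Wd G WL L (dobs \<omega>) m0 (m_tik Wd G WL L (dobs \<omega>) m0))
             (CARD('m) + CARD('p) - CARD('n)) 0) \<and>
        (m0 \<noteq> mhat \<longrightarrow>
           chi_squared M
             (\<lambda>\<omega>. tik_functional Wd G WL L (dobs \<omega>) m0 (m_tik Wd G WL L (dobs \<omega>) m0))
             (CARD('m) + CARD('p) - CARD('n))
             ((norm ((gsvd_Q q CARD('p) \<mu> ** transpose U ** Wd ** G) *v (mhat - m0)))\<^sup>2)))"
proof -
  note card = less_imp_le[OF assms(2)] assms(3) less_imp_le[OF assms(4)]
  have "matrix_inv Cd ** Cd = mat 1"
    by (rule matrix_inv_cancel(2)[OF sym_pos_def_invertible[OF assms(7)]])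
  then have "transpose Wd ** (Wd ** Cd) = mat 1" by (simp add: matrix_mul_assoc assms(14))
  then have Wd: "Wd ** Cd ** transpose Wd = mat 1" using matrix_left_right_inverse by blast
  then have "Wd ** (Cd ** transpose Wd) = mat 1" by (simp add: matrix_mul_assoc)
  then have Wd_inv: "invertible Wd" using invertible_right_inverse by blast

  have CL: "sym_pos_def CL"
    unfolding assms(13) by (rule sym_pos_def_congruence[OF assms(8,6)])
  note sqrt = matrix_sqrt_properties[OF sym_pos_def_imp_semidef[OF sym_pos_def_matrix_inv[OF CL]],
    folded assms(15)]
  have WLt: "transpose WL = WL" using sqrt(1) by (simp add: sym_pos_semidef_def)
  have "WL ** (WL ** CL) = mat 1"
    using matrix_inv_cancel(2)[OF sym_pos_def_invertible[OF CL]] by (simp add: matrix_mul_assoc sqrt(2))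
  then have WL: "WL ** CL ** WL = mat 1" and WL_inv: "invertible WL"
    using matrix_left_right_inverse invertible_right_inverse by blast+
  have cov: "(WL ** L) ** Cm ** transpose (WL ** L) = mat 1"
    using WL unfolding assms(13) by (simp add: matrix_transpose_mul WLt matrix_mul_assoc)

  have "rank (Wd ** G) = CARD('m)" "rank (WL ** L) = CARD('p)"
    by (simp_all add: rank_invertible_mult Wd_inv WL_inv assms(5,6))
  then have ex: "\<exists>U V X \<nu> \<mu>. is_gsvd (Wd ** G) (WL ** L) U V X \<nu> \<mu>"
    by (rule gsvd_exists[OF _ _ assms(16) card(1,2)])
  then have min: "\<forall>d. \<exists>!x. is_arg_min (tik_functional Wd G WL L d m0) (\<lambda>_. True) x"
    using tik_functional_arg_min(1)[OF _ card] by blast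
  have chi: "chi_squared M
      (\<lambda>\<omega>. tik_functional Wd G WL L (dobs \<omega>) m0 (m_tik Wd G WL L (dobs \<omega>) m0))
      (CARD('m) + CARD('p) - CARD('n))
      ((norm ((gsvd_Q q CARD('p) \<mu> ** transpose U ** Wd ** G) *v (mhat - m0)))\<^sup>2)"
    if gsvd: "is_gsvd (Wd ** G) (WL ** L) U V X \<nu> \<mu>" for U V X \<nu> \<mu>
    unfolding tik_functional_arg_min(2)[OF gsvd card] assms(12,17)
    by (rule minimum_law[OF assms(1) card assms(9-11) Wd assms(8) cov gsvd])
  have "chi_squared M
      (\<lambda>\<omega>. tik_functional Wd G WL L (dobs \<omega>) m0 (m_tik Wd G WL L (dobs \<omega>) m0))
      (CARD('m) + CARD('p) - CARD('n)) 0"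
    if "is_gsvd (Wd ** G) (WL ** L) U V X \<nu> \<mu>" "m0 = mhat" for U V X \<nu> \<mu>
    using chi[OF that(1)] that(2) by simp
  with ex min chi show ?thesis by blast
qed

end
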